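(* Let $0<M_1<M_2$ and $\Theta=\{\Sigma\succeq0:\lambda_{\max}(\Sigma)\le M_2,\ \lambda_{\min}(\Sigma)\ge M_1\}$. For $\Sigma^*\in\Theta$ let $P_{\Sigma^*}=\mathcal{N}(0,\Sigma^* )$, and consider data $X_1,\dots,X_n\stackrel{i.i.d.}{\sim}P$ with $W(P,P_{\Sigma^*})\le\epsilon$. There exist constants $C,c>0$ such that $$\inf_{\widehat\Sigma}\sup_{\Sigma^*\in\Theta,\;P:W(P_{\Sigma^*},P)\le\epsilon}\mathbb{P}\left(\|\Sigma^*-\widehat\Sigma\|_2\ge C\left(\sqrt{\frac pn}\vee\epsilon\right)\right)\ge c,$$ the infimum being over all estimators based on $X_1,\dots,X_n$.
   Context: $\|\cdot\|_2$ is the spectral norm; $W$ is the Wasserstein-1 distance $W(P,Q)=\inf_\Pi\mathbb{E}_\Pi\|X-Y\|_2$ over couplings.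
   Formalization: Proved for 1 ≤ p ≤ n and 0 ≤ ε ≤ 1, with C, c depending only on M1, M2; without a bound on p/n and ε the claim fails, since the constant estimator M1·I always has error at most M2 − M1. *)

theory Defs
  imports "HOL-Probability.Probability"
begin

text \<open>Vectors in R^p are functions nat => real (only indices < p matter),
  p x p matrices are functions nat => nat => real (only indices < p matter).\<close>

definition euclid_norm :: "nat \<Rightarrow> (nat \<Rightarrow> real) \<Rightarrow> real" where
  "euclid_norm p x = sqrt (\<Sum>i<p. (x i)\<^sup>2)"

definition mat_vec :: "nat \<Rightarrow> (nat \<Rightarrow> nat \<Rightarrow> real) \<Rightarrow> (nat \<Rightarrow> real) \<Rightarrow> (nat \<Rightarrow> real)" where
  "mat_vec p A x = (\<lambda>i. \<Sum>j<p. A i j * x j)"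

definition spec_norm :: "nat \<Rightarrow> (nat \<Rightarrow> nat \<Rightarrow> real) \<Rightarrow> real" where
  "spec_norm p A = Sup {euclid_norm p (mat_vec p A x) | x. euclid_norm p x \<le> 1}"

definition is_eigenvalue :: "nat \<Rightarrow> (nat \<Rightarrow> nat \<Rightarrow> real) \<Rightarrow> real \<Rightarrow> bool" where
  "is_eigenvalue p A l \<longleftrightarrow> (\<exists>v. (\<exists>i<p. v i \<noteq> 0) \<and> (\<forall>i<p. mat_vec p A v i = l * v i))"

definition lambda_max :: "nat \<Rightarrow> (nat \<Rightarrow> nat \<Rightarrow> real) \<Rightarrow> real" where
  "lambda_max p A = Max {l. is_eigenvalue p A l}"

definition lambda_min :: "nat \<Rightarrow> (nat \<Rightarrow> nat \<Rightarrow> real) \<Rightarrow> real" where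
  "lambda_min p A = Min {l. is_eigenvalue p A l}"

definition psd :: "nat \<Rightarrow> (nat \<Rightarrow> nat \<Rightarrow> real) \<Rightarrow> bool" where
  "psd p A \<longleftrightarrow> (\<forall>i<p. \<forall>j<p. A i j = A j i) \<and>
     (\<forall>x. 0 \<le> (\<Sum>i<p. \<Sum>j<p. x i * A i j * x j))"

definition Theta :: "real \<Rightarrow> real \<Rightarrow> nat \<Rightarrow> (nat \<Rightarrow> nat \<Rightarrow> real) set" where
  "Theta M1 M2 p = {S. psd p S \<and> lambda_max p S \<le> M2 \<and> lambda_min p S \<ge> M1}"

definition Rp :: "nat \<Rightarrow> (nat \<Rightarrow> real) measure" where
  "Rp p = PiM {..<p} (\<lambda>_. lborel)"

definition gaussian :: "nat \<Rightarrow> (nat \<Rightarrow> nat \<Rightarrow> real) \<Rightarrow> (nat \<Rightarrow> real) measure \<Rightarrow> bool" where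
  "gaussian p S G \<longleftrightarrow> prob_space G \<and> sets G = sets (Rp p) \<and>
     (\<forall>t. integral\<^sup>L G (\<lambda>x. cis (\<Sum>i<p. t i * x i))
          = complex_of_real (exp (- (\<Sum>i<p. \<Sum>j<p. t i * S i j * t j) / 2)))"

definition couplings :: "nat \<Rightarrow> (nat \<Rightarrow> real) measure \<Rightarrow> (nat \<Rightarrow> real) measure
    \<Rightarrow> ((nat \<Rightarrow> real) \<times> (nat \<Rightarrow> real)) measure set" where
  "couplings p P Q = {\<pi>. prob_space \<pi> \<and> sets \<pi> = sets (Rp p \<Otimes>\<^sub>M Rp p) \<and>
      distr \<pi> (Rp p) fst = P \<and> distr \<pi> (Rp p) snd = Q}"

definition wasserstein1 :: "nat \<Rightarrow> (nat \<Rightarrow> real) measure \<Rightarrow> (nat \<Rightarrow> real) measure \<Rightarrow> ennreal" where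
  "wasserstein1 p P Q = (INF \<pi>\<in>couplings p P Q.
      \<integral>\<^sup>+ z. ennreal (euclid_norm p (\<lambda>i. fst z i - snd z i)) \<partial>\<pi>)"

definition estimator :: "nat \<Rightarrow> nat \<Rightarrow> ((nat \<Rightarrow> nat \<Rightarrow> real) \<Rightarrow> (nat \<Rightarrow> nat \<Rightarrow> real)) \<Rightarrow> bool" where
  "estimator p n E \<longleftrightarrow> (\<forall>i<p. \<forall>j<p.
      (\<lambda>X. E X i j) \<in> borel_measurable (PiM {..<n} (\<lambda>_. Rp p)))"

end

theory Submission
  imports Defs
begin

text \<open>If \<open>\<epsilon>\<close> dominates, contaminate one Gaussian \<open>P = N(0, A I)\<close>: rescaling its first
  coordinate moves it by \<open>O(\<epsilon>)\<close> in Wasserstein distance and its covariance by order \<open>\<epsilon>\<close>, so both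
  covariances are compatible with the same data law \<open>P\<close>, and no estimator is close to both.

  If \<open>sqrt (p / n)\<close> dominates, apply Assouad's lemma to \<open>2\<^sup>p\<close> Gaussian laws indexed by signs \<open>v\<close>: with
  \<open>t\<close> of order \<open>1 / sqrt n\<close>, \<open>X\<^sub>0\<close> is centred with variance \<open>A / (1 - v\<^sub>0 t)\<close> and, given \<open>X\<^sub>0\<close>, the other
  \<open>X\<^sub>j\<close> are independent \<open>N(t v\<^sub>j X\<^sub>0, A)\<close>. Flipping one sign leaves the Hellinger affinity of one
  observation above \<open>1 - t\<^sup>2\<close>, hence that of \<open>n\<close> observations bounded below, so a constant fraction of
  the signs is undecidable. The signs are read off the first column of the covariance matrix with
  margin of order \<open>t\<close>, so that the spectral norm error is of order \<open>t * sqrt p\<close>. The sign \<open>v\<^sub>0\<close>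
  serves to cover \<open>p = 1\<close>.\<close>

subsection \<open>Assouad's lemma\<close>

text \<open>A product measure is determined by its values on boxes. The indicator of a box
  factorises over the coordinates, so Tonelli splits the integral of the product density.\<close>

lemma density_PiM:
  assumes I: "finite I" and M: "sigma_finite_measure M" and f [measurable]: "f \<in> borel_measurable M"
    and sf: "sigma_finite_measure (density M f)"
  shows "PiM I (\<lambda>_. density M f) = density (PiM I (\<lambda>_. M)) (\<lambda>x. \<Prod>i\<in>I. f (x i))"
proof -
  interpret M: product_sigma_finite "\<lambda>_. M" using M by (simp add: product_sigma_finite_def)
  interpret D: product_sigma_finite "\<lambda>_. density M f" using sf by (simp add: product_sigma_finite_def)
  show ?thesis
  proof (rule D.PiM_eqI[OF I, symmetric])
    show "sets (density (PiM I (\<lambda>_. M)) (\<lambda>x. \<Prod>i\<in>I. f (x i))) = sets (PiM I (\<lambda>_. density M f))"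
      by (simp cong: sets_PiM_cong)
  next
    fix A assume A: "\<And>i. i \<in> I \<Longrightarrow> A i \<in> sets (density M f)"
    have A' [measurable]: "i \<in> I \<Longrightarrow> A i \<in> sets M" for i using A by simp
    have [measurable]: "Pi\<^sub>E I A \<in> sets (PiM I (\<lambda>_. M))" using A' I by (intro sets_PiM_I_finite) auto
    have "emeasure (density (PiM I (\<lambda>_. M)) (\<lambda>x. \<Prod>i\<in>I. f (x i))) (Pi\<^sub>E I A)
       = (\<integral>\<^sup>+ x. (\<Prod>i\<in>I. f (x i)) * indicator (Pi\<^sub>E I A) x \<partial>PiM I (\<lambda>_. M))"
      by (intro emeasure_density) measurable
    also have "\<dots> = (\<integral>\<^sup>+ x. (\<Prod>i\<in>I. f (x i) * indicator (A i) (x i)) \<partial>PiM I (\<lambda>_. M))"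
    proof (rule nn_integral_cong)
      fix x assume "x \<in> space (PiM I (\<lambda>_. M))"
      then have "indicator (Pi\<^sub>E I A) x = (\<Prod>i\<in>I. indicator (A i) (x i) :: ennreal)"
        using I by (auto simp: indicator_def space_PiM PiE_iff prod_zero_iff intro!: prod.neutral)
      then show "(\<Prod>i\<in>I. f (x i)) * indicator (Pi\<^sub>E I A) x = (\<Prod>i\<in>I. f (x i) * indicator (A i) (x i))"
        by (simp add: prod.distrib)
    qed
    also have "\<dots> = (\<Prod>i\<in>I. \<integral>\<^sup>+ x. f x * indicator (A i) x \<partial>M)"
      by (rule M.product_nn_integral_prod[OF I]) measurable
    also have "\<dots> = (\<Prod>i\<in>I. emeasure (density M f) (A i))"
      by (intro prod.cong refl emeasure_density[symmetric]) measurable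
    finally show "emeasure (density (PiM I (\<lambda>_. M)) (\<lambda>x. \<Prod>i\<in>I. f (x i))) (Pi\<^sub>E I A)
      = (\<Prod>i\<in>I. emeasure (density M f) (A i))" .
  qed
qed

text \<open>Le Cam's two-point bound: a large Hellinger affinity makes every test \<open>D\<close>
  err. A linear pointwise bound on \<open>sqrt (f * g)\<close> replaces the usual Cauchy-Schwarz
  argument; integrating it gives \<open>7/8 \<le> 3/4 * errors + 1/2\<close>.\<close>

lemma testing_lower_bound:
  assumes [measurable]: "f \<in> borel_measurable M" "g \<in> borel_measurable M" "D \<in> sets M"
    and nn: "\<And>x. 0 \<le> f x" "\<And>x. 0 \<le> g x"
    and P: "prob_space (density M (\<lambda>x. ennreal (f x)))" (is "prob_space ?P")
    and Q: "prob_space (density M (\<lambda>x. ennreal (g x)))" (is "prob_space ?Q")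
    and aff: "ennreal (7/8) \<le> (\<integral>\<^sup>+ x. ennreal (sqrt (f x * g x)) \<partial>M)"
  shows "1/2 \<le> measure ?P D + measure ?Q (space M - D)"
proof -
  interpret P: prob_space ?P by fact
  interpret Q: prob_space ?Q by fact
  have 1: "(\<integral>\<^sup>+ x. ennreal (f x) \<partial>M) = 1" "(\<integral>\<^sup>+ x. ennreal (g x) \<partial>M) = 1"
    using P.emeasure_space_1 Q.emeasure_space_1 by (simp_all add: emeasure_density cong: nn_integral_cong)
  have am_gm: "sqrt (a * b) \<le> a * 3 / 4 + (a + b) / 4" if "0 \<le> a" "0 \<le> b" for a b :: real
  proof -
    \<comment> \<open>The unequal weights give \<open>a + b / 4\<close>. Taking \<open>a\<close> to
      be the density counted as error at the point, the symmetric part integrates to only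
      \<open>1/2\<close>, which is below \<open>7/8\<close>.\<close>
    have "sqrt (a * b) = sqrt ((2 * a) * (b / 2))" by simp
    also have "\<dots> \<le> (2 * a + b / 2) / 2" using that by (intro arith_geo_mean_sqrt) auto
    finally show ?thesis by (simp add: field_simps)
  qed
  have "ennreal (7/8) \<le> (\<integral>\<^sup>+ x. ennreal (sqrt (f x * g x)) \<partial>M)" by fact
  also have "\<dots> \<le> (\<integral>\<^sup>+ x. ennreal (3/4) * (ennreal (f x) * indicator D x + ennreal (g x) * indicator (space M - D) x)
        + ennreal (1/4) * (ennreal (f x) + ennreal (g x)) \<partial>M)"
  proof (rule nn_integral_mono)
    fix x assume "x \<in> space M"
    then show "ennreal (sqrt (f x * g x)) \<le> ennreal (3/4) * (ennreal (f x) * indicator D x + ennreal (g x) * indicator (space M - D) x)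
        + ennreal (1/4) * (ennreal (f x) + ennreal (g x))"
      using nn[of x] am_gm[of "f x" "g x"] am_gm[of "g x" "f x"]
      by (cases "x \<in> D") (auto simp: mult.commute add.commute simp flip: ennreal_plus ennreal_mult'' intro!: ennreal_leI)
  qed
  also have "\<dots> = ennreal (3/4) * (emeasure ?P D + emeasure ?Q (space M - D)) + ennreal (1/4) * (1 + 1)"
    by (simp add: nn_integral_add nn_integral_cmult emeasure_density 1)
  also have "\<dots> = ennreal (3/4 * (measure ?P D + measure ?Q (space M - D)) + 1/2)"
  proof -
    have "ennreal (3/4) * (ennreal x + ennreal y) + ennreal (1/4) * (1 + 1) = ennreal (3/4 * (x + y) + 1/2)"
      if xy: "0 \<le> x" "0 \<le> y" for x y
    proof -
      have "ennreal (3/4 * (x + y) + 1/4 * 2) = ennreal (3/4 * (x + y)) + ennreal (1/4 * 2)"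
        using xy by (intro ennreal_plus) auto
      also have "ennreal (3/4 * (x + y)) = ennreal (3/4) * (ennreal x + ennreal y)"
        using xy by (subst ennreal_mult) auto
      also have "ennreal (1/4 * 2) = ennreal (1/4) * ennreal 2" by (rule ennreal_mult) auto
      also have "ennreal 2 = 1 + 1" by simp
      finally show ?thesis by simp
    qed
    then show ?thesis unfolding P.emeasure_eq_measure Q.emeasure_eq_measure by simp
  qed
  finally have "7/8 \<le> 3/4 * (measure ?P D + measure ?Q (space M - D)) + 1/2"
    by (subst (asm) ennreal_le_iff) (auto intro: add_nonneg_nonneg)
  then show ?thesis by simp
qed

text \<open>The affinity is multiplicative over independent observations, and Bernoulli's inequality
  keeps \<open>(1 - 1 / (8 * n)) ^ n\<close> above \<open>7/8\<close>.\<close>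

lemma testing_lower_bound_iid:
  fixes f g :: "'a \<Rightarrow> real"
  assumes M: "sigma_finite_measure M"
    and [measurable]: "f \<in> borel_measurable M" "g \<in> borel_measurable M"
    and D: "D \<in> sets (PiM {..<n} (\<lambda>_. M))"
    and nn: "\<And>x. 0 \<le> f x" "\<And>x. 0 \<le> g x"
    and P: "prob_space (density M (\<lambda>x. ennreal (f x)))" (is "prob_space ?P")
    and Q: "prob_space (density M (\<lambda>x. ennreal (g x)))" (is "prob_space ?Q")
    and n: "1 \<le> n"
    and aff: "ennreal (1 - 1 / (8 * real n)) \<le> (\<integral>\<^sup>+ x. ennreal (sqrt (f x * g x)) \<partial>M)"
  shows "1/2 \<le> measure (PiM {..<n} (\<lambda>_. ?P)) D + measure (PiM {..<n} (\<lambda>_. ?Q)) (space (PiM {..<n} (\<lambda>_. M)) - D)"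
proof -
  interpret M: product_sigma_finite "\<lambda>_. M" using M by (simp add: product_sigma_finite_def)
  have PP: "PiM {..<n} (\<lambda>_. ?P) = density (PiM {..<n} (\<lambda>_. M)) (\<lambda>x. ennreal (\<Prod>i<n. f (x i)))"
    using P nn by (subst density_PiM) (auto simp: M prod_ennreal dest: prob_space_imp_sigma_finite)
  have QQ: "PiM {..<n} (\<lambda>_. ?Q) = density (PiM {..<n} (\<lambda>_. M)) (\<lambda>x. ennreal (\<Prod>i<n. g (x i)))"
    using Q nn by (subst density_PiM) (auto simp: M prod_ennreal dest: prob_space_imp_sigma_finite)
  have prP: "prob_space (PiM {..<n} (\<lambda>_. ?P))" and prQ: "prob_space (PiM {..<n} (\<lambda>_. ?Q))"
    using P Q by (auto intro: prob_space_PiM)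
  have "7/8 \<le> 1 + real n * (- (1 / (8 * real n)))" using n by simp
  also have "\<dots> \<le> (1 + (- (1 / (8 * real n)))) ^ n"
    using n by (intro Bernoulli_inequality) (auto simp: field_simps)
  finally have "ennreal (7/8) \<le> ennreal (1 - 1 / (8 * real n)) ^ n"
    using n by (subst ennreal_power) (auto simp: field_simps intro!: ennreal_leI)
  also have "\<dots> \<le> (\<integral>\<^sup>+ x. ennreal (sqrt (f x * g x)) \<partial>M) ^ n"
    using aff by (intro power_mono) auto
  also have "\<dots> = (\<Prod>i<n. \<integral>\<^sup>+ x. ennreal (sqrt (f x * g x)) \<partial>M)" by simp
  also have "\<dots> = (\<integral>\<^sup>+ x. (\<Prod>i<n. ennreal (sqrt (f (x i) * g (x i)))) \<partial>PiM {..<n} (\<lambda>_. M))"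
    by (subst M.product_nn_integral_prod) auto
  also have "\<dots> = (\<integral>\<^sup>+ x. ennreal (sqrt ((\<Prod>i<n. f (x i)) * (\<Prod>i<n. g (x i)))) \<partial>PiM {..<n} (\<lambda>_. M))"
  proof -
    have "(\<Prod>i\<in>I. sqrt (f (x i) * g (x i))) = sqrt ((\<Prod>i\<in>I. f (x i)) * (\<Prod>i\<in>I. g (x i)))" if "finite I" for I :: "nat set" and x
      using that by (induction I rule: finite_induct) (auto simp: real_sqrt_mult)
    then show ?thesis using nn by (simp add: prod_ennreal)
  qed
  finally show ?thesis
    unfolding PP QQ using nn D prP prQ
    by (intro testing_lower_bound) (auto simp: PP QQ intro!: prod_nonneg)
qed

section \<open>The sign hypercube and the number of wrong signs\<close>

definition flip_at :: "nat \<Rightarrow> (nat \<Rightarrow> real) \<Rightarrow> nat \<Rightarrow> real" where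
  "flip_at j v = v(j := - v j)"

text \<open>Extensional functions are used so that the cube is a finite set and can be averaged
  over.\<close>

definition sign_cube :: "nat \<Rightarrow> (nat \<Rightarrow> real) set" where
  "sign_cube p = {..<p} \<rightarrow>\<^sub>E {-1, 1}"

lemma flip_at_sign_cube: "j < p \<Longrightarrow> v \<in> sign_cube p \<Longrightarrow> flip_at j v \<in> sign_cube p"
  by (auto simp: flip_at_def sign_cube_def PiE_iff extensional_def)

text \<open>Reverse Markov inequality: the count is at most \<open>p\<close> always and below
  \<open>p / 8\<close> off the event, so a mean of at least \<open>p / 4\<close> forces the event to
  have probability at least \<open>1/8\<close>.\<close>

lemma markov_card:
  assumes P: "prob_space P" and B: "\<And>j. j < p \<Longrightarrow> B j \<in> sets P" and p: "1 \<le> p"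
    and sum: "real p / 4 \<le> (\<Sum>j<p. measure P (B j))"
  shows "1/8 \<le> measure P {X \<in> space P. real p / 8 \<le> real (card {j. j < p \<and> X \<in> B j})}"
proof -
  interpret P: prob_space P by fact
  have [measurable]: "j \<in> {..<p} \<Longrightarrow> B j \<in> sets P" for j using B by simp
  have card_eq: "real (card {j. j < p \<and> X \<in> B j}) = (\<Sum>j<p. indicator (B j) X)" for X
    by (simp add: indicator_def sum.If_cases Int_def Collect_conj_eq[symmetric] lessThan_def)
  let ?S = "{X \<in> space P. real p / 8 \<le> (\<Sum>j<p. indicator (B j) X :: real)}"
  have [measurable]: "?S \<in> sets P" by measurable
  have "real p / 4 \<le> (\<Sum>j<p. \<integral>X. indicator (B j) X \<partial>P)" using sum B by simp
  also have "\<dots> = (\<integral>X. (\<Sum>j<p. indicator (B j) X) \<partial>P)"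
    using B by (intro Bochner_Integration.integral_sum[symmetric]) (auto simp: integrable_real_indicator less_top[symmetric])
  also have "\<dots> \<le> (\<integral>X. real p * indicator ?S X + real p / 8 \<partial>P)"
  proof (rule integral_mono)
    fix X assume "X \<in> space P"
    have "(\<Sum>j<p. indicator (B j) X) \<le> (\<Sum>j<p. 1 :: real)" by (intro sum_mono) (auto simp: indicator_def)
    then show "(\<Sum>j<p. indicator (B j) X) \<le> real p * indicator ?S X + real p / 8"
      using \<open>X \<in> space P\<close> by (auto simp: indicator_def)
  qed (auto intro!: integrable_real_indicator Bochner_Integration.integrable_sum simp: B less_top[symmetric])
  also have "\<dots> = real p * measure P ?S + real p / 8"
    by (subst Bochner_Integration.integral_add) (auto simp: less_top[symmetric] P.prob_space intro!: integrable_real_indicator)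
  finally have "real p * (1/8) \<le> real p * measure P ?S" by simp
  then show ?thesis using p unfolding card_eq by simp
qed

text \<open>\<open>D j\<close> is the event that sign \<open>j\<close> is declared positive. Each
  sign is hard to test between neighbours of the cube, so averaged over the cube it is wrong with
  probability at least \<open>1/4\<close>; some vertex does no better than the average, and
  \<open>markov_card\<close> turns its expected number of errors into a probability.\<close>

lemma assouad:
  fixes P :: "(nat \<Rightarrow> real) \<Rightarrow> 'a measure"
  assumes p: "1 \<le> p"
    and P: "\<And>v. v \<in> sign_cube p \<Longrightarrow> prob_space (P v)"
    and sets: "\<And>v. v \<in> sign_cube p \<Longrightarrow> sets (P v) = sets M"
    and D: "\<And>j. j < p \<Longrightarrow> D j \<in> sets M"
    and test: "\<And>v j A. v \<in> sign_cube p \<Longrightarrow> j < p \<Longrightarrow> A \<in> sets M \<Longrightarrow>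
      1/2 \<le> measure (P v) A + measure (P (flip_at j v)) (space M - A)"
  shows "\<exists>v\<in>sign_cube p. 1/8 \<le> measure (P v)
    {X \<in> space M. real p / 8 \<le> real (card {j. j < p \<and> (v j = 1 \<longleftrightarrow> X \<notin> D j)})}"
proof -
  define V where "V = sign_cube p"
  define B where "B v j = (if v j = 1 then space M - D j else D j)" for v :: "nat \<Rightarrow> real" and j
  have fin: "finite V" and card: "0 < card V"
    by (auto simp: V_def sign_cube_def card_PiE intro!: finite_PiE)
  have B: "B v j \<in> sets M" if "j < p" for v j using D that by (auto simp: B_def)
  have pair: "card V / 4 \<le> (\<Sum>v\<in>V. measure (P v) (B v j))" if j: "j < p" for j
  proof -
    \<comment> \<open>\<open>flip_at j\<close> is an involution of the cube, so the doubled sum runs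
      over neighbouring pairs, and the two error events of a pair are complementary.\<close>
    have "(\<Sum>v\<in>V. measure (P v) (B v j)) = (\<Sum>v\<in>V. measure (P (flip_at j v)) (B (flip_at j v) j))"
      by (rule sum.reindex_bij_witness[where i = "flip_at j" and j = "flip_at j"])
         (use j in \<open>auto simp: V_def flip_at_sign_cube\<close>, auto simp: flip_at_def)
    then have "2 * (\<Sum>v\<in>V. measure (P v) (B v j))
      = (\<Sum>v\<in>V. measure (P v) (B v j) + measure (P (flip_at j v)) (B (flip_at j v) j))"
      by (simp add: sum.distrib)
    also have "\<dots> \<ge> (\<Sum>v\<in>V. 1/2)"
    proof (rule sum_mono)
      fix v assume v: "v \<in> V"
      then have "v j = 1 \<or> v j = -1" using j by (auto simp: V_def sign_cube_def PiE_iff)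
      then have "B (flip_at j v) j = space M - B v j"
        using sets.sets_into_space[OF D[OF j]] by (auto simp: B_def flip_at_def)
      then show "1/2 \<le> measure (P v) (B v j) + measure (P (flip_at j v)) (B (flip_at j v) j)"
        using test[of v j "B v j"] B j v by (simp add: V_def)
    qed
    finally show ?thesis by simp
  qed
  have "\<exists>v\<in>V. real p / 4 \<le> (\<Sum>j<p. measure (P v) (B v j))"
  proof (rule ccontr)
    assume "\<not> ?thesis"
    then have "(\<Sum>v\<in>V. \<Sum>j<p. measure (P v) (B v j)) < (\<Sum>v\<in>V. real p / 4)"
      using fin card by (intro sum_strict_mono) auto
    moreover have "(\<Sum>j<p. card V / 4) \<le> (\<Sum>j<p. \<Sum>v\<in>V. measure (P v) (B v j))"
      using pair by (intro sum_mono) auto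
    ultimately show False by (subst (asm) (2) sum.swap) (simp add: mult.commute)
  qed
  then obtain v where v: "v \<in> sign_cube p" "real p / 4 \<le> (\<Sum>j<p. measure (P v) (B v j))"
    by (auto simp: V_def)
  have sp: "space (P v) = space M" using sets[OF v(1)] by (rule sets_eq_imp_space_eq)
  have "1/8 \<le> measure (P v) {X \<in> space M. real p / 8 \<le> real (card {j. j < p \<and> X \<in> B v j})}"
    using markov_card[OF P[OF v(1)] _ p v(2)] B sets[OF v(1)] sp by simp
  also have "{X \<in> space M. real p / 8 \<le> real (card {j. j < p \<and> X \<in> B v j})}
    = {X \<in> space M. real p / 8 \<le> real (card {j. j < p \<and> (v j = 1 \<longleftrightarrow> X \<notin> D j)})}"
    by (rule Collect_cong, rule conj_cong, rule refl,
        rule arg_cong[where f = "\<lambda>S. real p / 8 \<le> real (card S)"]) (auto simp: B_def)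
  finally show ?thesis using v(1) by blast
qed

subsection \<open>Gaussian laws with star-shaped dependence\<close>

lemma measurable_cis_compose [measurable]:
  "f \<in> borel_measurable M \<Longrightarrow> (\<lambda>x. cis (f x)) \<in> borel_measurable M"
  unfolding cis_conv_exp by measurable

lemma integral_cis_normal_density:
  assumes "0 < s"
  shows "(\<integral>y. complex_of_real (normal_density m s y) * cis (t * y) \<partial>lborel)
    = cis (t * m) * complex_of_real (exp (- (s\<^sup>2 * t\<^sup>2) / 2))"
proof -
  have std: "(\<integral>y. complex_of_real (std_normal_density y) * cis (r * y) \<partial>lborel)
      = complex_of_real (exp (- r\<^sup>2 / 2))" for r
  proof -
    have "complex_of_real (exp (- r\<^sup>2 / 2)) = char std_normal_distribution r"
      by (simp add: char_std_normal_distribution)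
    also have "\<dots> = (\<integral>y. std_normal_density y *\<^sub>R iexp (r * y) \<partial>lborel)"
      unfolding char_def by (subst integral_density) auto
    finally show ?thesis
      by (simp add: scaleR_conv_of_real cis_conv_exp)
  qed
  have "(\<integral>y. complex_of_real (normal_density m s y) * cis (t * y) \<partial>lborel)
     = s *\<^sub>R (\<integral>y. complex_of_real (normal_density m s (m + s * y)) * cis (t * (m + s * y)) \<partial>lborel)"
    using assms by (subst lborel_integral_real_affine[where c = s and t = m]) auto
  also have "\<dots> = (\<integral>y. cis (t * m) * (complex_of_real (std_normal_density y) * cis (t * s * y)) \<partial>lborel)"
    using assms
    by (simp add: normal_density_def cis_mult[symmetric] algebra_simps real_sqrt_mult power_mult_distrib
        flip: integral_scaleR_right)
       (simp add: scaleR_conv_of_real mult_ac cis_mult distrib_left)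
  also have "\<dots> = cis (t * m) * complex_of_real (exp (- (s\<^sup>2 * t\<^sup>2) / 2))"
    using std[of "t * s"] by (simp add: power_mult_distrib mult_ac)
  finally show ?thesis .
qed

text \<open>Gaussian regression of the coordinates \<open>1, ..., p - 1\<close> on coordinate \<open>0\<close>; the value \<open>u 0\<close>
  is irrelevant.\<close>
definition star_dens :: "nat \<Rightarrow> real \<Rightarrow> real \<Rightarrow> (nat \<Rightarrow> real) \<Rightarrow> (nat \<Rightarrow> real) \<Rightarrow> real" where
  "star_dens p \<sigma> s u x =
     normal_density 0 \<sigma> (x 0) * (\<Prod>j\<in>{1..<p}. normal_density (u j * x 0) s (x j))"

text \<open>This is the covariance of \<open>X 0\<close> with variance
  \<open>\<sigma>\<^sup>2\<close> and \<open>X j = u j * X 0 + s * Z j\<close>, with independent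
  standard \<open>Z j\<close>: a rank-one matrix plus \<open>s\<^sup>2\<close> on the diagonal away
  from index 0.\<close>

definition star_cov :: "real \<Rightarrow> real \<Rightarrow> (nat \<Rightarrow> real) \<Rightarrow> nat \<Rightarrow> nat \<Rightarrow> real" where
  "star_cov \<sigma> s u i j = \<sigma>\<^sup>2 * (if i = 0 then 1 else u i) * (if j = 0 then 1 else u j)
     + (if i = j \<and> 1 \<le> i then s\<^sup>2 else 0)"

interpretation lborel_pr: product_sigma_finite "\<lambda>_::nat. lborel :: real measure"
  by standard

lemma star_dens_nonneg: "0 \<le> star_dens p \<sigma> s u x"
  by (simp add: star_dens_def prod_nonneg)

lemma measurable_normal_density_compose [measurable]:
  assumes [measurable]: "f \<in> borel_measurable M" "g \<in> borel_measurable M"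
  shows "(\<lambda>x. normal_density (f x) s (g x)) \<in> borel_measurable M"
  unfolding normal_density_def by measurable

lemma measurable_Rp_component: "i < p \<Longrightarrow> (\<lambda>x. x i) \<in> borel_measurable (Rp p)"
  unfolding Rp_def by (metis lessThan_iff measurable_component_singleton measurable_lborel1)

lemma measurable_star_dens [measurable]:
  "1 \<le> p \<Longrightarrow> star_dens p \<sigma> s u \<in> borel_measurable (Rp p)"
  unfolding star_dens_def by (intro borel_measurable_times borel_measurable_prod measurable_normal_density_compose
    measurable_Rp_component) auto

lemma Rp_Suc: "Rp (Suc p) = PiM (insert p {..<p}) (\<lambda>_. lborel)"
  unfolding Rp_def by (simp add: lessThan_Suc)

lemma star_dens_Suc:
  assumes "1 \<le> p"
  shows "star_dens (Suc p) \<sigma> s u (x(p := y)) = star_dens p \<sigma> s u x * normal_density (u p * x 0) s y"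
proof -
  have "{1..<Suc p} = insert p {1..<p}" using assms by auto
  then show ?thesis using assms by (simp add: star_dens_def prod.insert)
qed

lemma nn_integral_normal_density: "0 < s \<Longrightarrow> (\<integral>\<^sup>+ y. ennreal (normal_density m s y) \<partial>lborel) = 1"
  by (subst nn_integral_eq_integral) auto

text \<open>Coordinate 0 has marginal \<open>N(0, \<sigma>\<^sup>2)\<close>: the last coordinate
  always integrates to 1, whatever its conditional mean. Keeping a general \<open>h\<close> serves
  the total mass, the affinity and the transport cost alike.\<close>

lemma nn_integral_star_dens:
  assumes "1 \<le> p" "0 < s" and [measurable]: "h \<in> borel_measurable borel"
  shows "(\<integral>\<^sup>+ x. ennreal (star_dens p \<sigma> s u x) * h (x 0) \<partial>Rp p)
    = (\<integral>\<^sup>+ y. ennreal (normal_density 0 \<sigma> y) * h y \<partial>lborel)"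
  using assms(1)
proof (induction p rule: dec_induct)
  case base
  have "{..<Suc 0} = {0}" by auto
  then show ?case
    unfolding Rp_def star_dens_def
    using lborel_pr.product_nn_integral_singleton[where i = 0 and f = "\<lambda>y. ennreal (normal_density 0 \<sigma> y) * h y"]
    by simp
next
  case (step p)
  note measurable_Rp_component [measurable]
  have [measurable]: "(\<lambda>x. ennreal (star_dens (Suc p) \<sigma> s u x) * h (x 0)) \<in> borel_measurable (Rp (Suc p))"
    using step.hyps by measurable
  have "(\<integral>\<^sup>+ x. ennreal (star_dens (Suc p) \<sigma> s u x) * h (x 0) \<partial>Rp (Suc p))
    = (\<integral>\<^sup>+ x. (\<integral>\<^sup>+ y. ennreal (star_dens (Suc p) \<sigma> s u (x(p := y))) * h ((x(p := y)) 0) \<partial>lborel) \<partial>Rp p)"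
    unfolding Rp_Suc Rp_def[of p]
    by (rule lborel_pr.product_nn_integral_insert) (auto simp flip: Rp_Suc)
  also have "\<dots> = (\<integral>\<^sup>+ x. ennreal (star_dens p \<sigma> s u x) * h (x 0) \<partial>Rp p)"
  proof (rule nn_integral_cong)
    fix x
    have "(\<integral>\<^sup>+ y. ennreal (star_dens (Suc p) \<sigma> s u (x(p := y))) * h ((x(p := y)) 0) \<partial>lborel)
      = (\<integral>\<^sup>+ y. (ennreal (star_dens p \<sigma> s u x) * h (x 0)) * ennreal (normal_density (u p * x 0) s y) \<partial>lborel)"
      using step.hyps by (simp only: star_dens_Suc) (simp add: ennreal_mult star_dens_nonneg mult_ac)
    also have "\<dots> = ennreal (star_dens p \<sigma> s u x) * h (x 0)"
      using assms(2) by (subst nn_integral_cmult) (auto simp: nn_integral_normal_density)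
    finally show "(\<integral>\<^sup>+ y. ennreal (star_dens (Suc p) \<sigma> s u (x(p := y))) * h ((x(p := y)) 0) \<partial>lborel)
      = ennreal (star_dens p \<sigma> s u x) * h (x 0)" .
  qed
  finally show ?case using step.IH by simp
qed

section \<open>Total mass and characteristic function of the star-shaped laws\<close>

definition star_law :: "nat \<Rightarrow> real \<Rightarrow> real \<Rightarrow> (nat \<Rightarrow> real) \<Rightarrow> (nat \<Rightarrow> real) measure" where
  "star_law p \<sigma> s u = density (Rp p) (\<lambda>x. ennreal (star_dens p \<sigma> s u x))"

lemma nn_integral_star_dens_1:
  assumes "1 \<le> p" "0 < s" "0 < \<sigma>"
  shows "(\<integral>\<^sup>+ x. ennreal (star_dens p \<sigma> s u x) \<partial>Rp p) = 1"
  using nn_integral_star_dens[OF assms(1,2), of "\<lambda>_. 1" \<sigma> u] assms by (simp add: nn_integral_normal_density)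

lemma sets_star_law: "sets (star_law p \<sigma> s u) = sets (Rp p)"
  by (simp add: star_law_def)

lemma prob_space_star_law:
  assumes "1 \<le> p" "0 < s" "0 < \<sigma>"
  shows "prob_space (star_law p \<sigma> s u)"
proof
  show "emeasure (star_law p \<sigma> s u) (space (star_law p \<sigma> s u)) = 1"
    unfolding star_law_def using nn_integral_star_dens_1[OF assms] assms(1)
    by (simp add: emeasure_density cong: nn_integral_cong)
qed

lemma integrable_star_dens:
  assumes "1 \<le> p" "0 < s" "0 < \<sigma>"
  shows "integrable (Rp p) (star_dens p \<sigma> s u)"
  using nn_integral_star_dens_1[OF assms] assms(1)
  by (intro integrableI_nonneg) (auto simp: star_dens_nonneg)

text \<open>Integrating out coordinate \<open>p\<close> leaves a constant factor and a phase linear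
  in \<open>x 0\<close>. The phase is absorbed by shifting \<open>t 0\<close>, which is why the
  induction must generalise over \<open>t\<close>.\<close>

lemma integral_cis_star_dens:
  assumes "1 \<le> p" "0 < s" "0 < \<sigma>"
  shows "(\<integral>x. complex_of_real (star_dens p \<sigma> s u x) * cis (\<Sum>i<p. t i * x i) \<partial>Rp p)
    = complex_of_real (exp (- (\<sigma>\<^sup>2 * (t 0 + (\<Sum>j=1..<p. u j * t j))\<^sup>2 + s\<^sup>2 * (\<Sum>j=1..<p. (t j)\<^sup>2)) / 2))"
  using assms(1)
proof (induction p arbitrary: t rule: dec_induct)
  case base
  have "(\<lambda>y. complex_of_real (normal_density 0 \<sigma> y) * cis (t 0 * y)) \<in> borel_measurable lborel"
    by measurable
  from lborel_pr.product_integral_singleton[where i = 0, OF this]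
  show ?case
    using integral_cis_normal_density[OF assms(3), of 0 "t 0"]
    by (simp add: Rp_def star_dens_def lessThan_Suc)
next
  case (step p)
  note measurable_Rp_component [measurable]
  define t' where "t' = t(0 := t 0 + u p * t p)"
  \<comment> \<open>Fubini needs integrability; the phase has modulus 1, so the density
    dominates.\<close>
  have int: "integrable (Rp (Suc p)) (\<lambda>x. complex_of_real (star_dens (Suc p) \<sigma> s u x) * cis (\<Sum>i<Suc p. t i * x i))"
  proof (rule Bochner_Integration.integrable_bound[OF integrable_star_dens[where p = "Suc p" and u = u]])
    show "(\<lambda>x. complex_of_real (star_dens (Suc p) \<sigma> s u x) * cis (\<Sum>i<Suc p. t i * x i)) \<in> borel_measurable (Rp (Suc p))"
      by measurable
  qed (auto simp: assms norm_mult)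
  have "(\<integral>x. complex_of_real (star_dens (Suc p) \<sigma> s u x) * cis (\<Sum>i<Suc p. t i * x i) \<partial>Rp (Suc p))
     = (\<integral>x. (\<integral>y. complex_of_real (star_dens (Suc p) \<sigma> s u (x(p := y))) * cis (\<Sum>i<Suc p. t i * (x(p := y)) i) \<partial>lborel) \<partial>Rp p)"
    using int unfolding Rp_Suc Rp_def[of p]
    by (intro lborel_pr.product_integral_insert) auto
  also have "\<dots> = (\<integral>x. complex_of_real (exp (- (s\<^sup>2 * (t p)\<^sup>2) / 2)) *
       (complex_of_real (star_dens p \<sigma> s u x) * cis (\<Sum>i<p. t' i * x i)) \<partial>Rp p)"
  proof (rule Bochner_Integration.integral_cong[OF refl])
    fix x
    have sum': "(\<Sum>i<p. t' i * x i) = (\<Sum>i<p. t i * x i) + t p * (u p * x 0)"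
    proof -
      have "(\<Sum>i<p. t' i * x i) = (\<Sum>i<p. t i * x i + (if i = 0 then u p * t p * x 0 else 0))"
        by (intro sum.cong) (auto simp: t'_def algebra_simps)
      also have "\<dots> = (\<Sum>i<p. t i * x i) + t p * (u p * x 0)"
        using step.hyps by (simp add: sum.distrib mult_ac)
      finally show ?thesis .
    qed
    have "(\<Sum>i<Suc p. t i * (x(p := y)) i) = (\<Sum>i<p. t i * x i) + t p * y" for y
      by simp
    then have "(\<integral>y. complex_of_real (star_dens (Suc p) \<sigma> s u (x(p := y))) * cis (\<Sum>i<Suc p. t i * (x(p := y)) i) \<partial>lborel)
      = (\<integral>y. complex_of_real (star_dens p \<sigma> s u x) * cis (\<Sum>i<p. t i * x i) *
           (complex_of_real (normal_density (u p * x 0) s y) * cis (t p * y)) \<partial>lborel)"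
      using step.hyps
      by (simp only: star_dens_Suc cis_mult[symmetric]) (simp add: mult_ac)
    also have "\<dots> = complex_of_real (star_dens p \<sigma> s u x) * cis (\<Sum>i<p. t i * x i) *
        (cis (t p * (u p * x 0)) * complex_of_real (exp (- (s\<^sup>2 * (t p)\<^sup>2) / 2)))"
      by (simp add: integral_cis_normal_density[OF assms(2)])
    also have "\<dots> = complex_of_real (exp (- (s\<^sup>2 * (t p)\<^sup>2) / 2)) *
       (complex_of_real (star_dens p \<sigma> s u x) * cis (\<Sum>i<p. t' i * x i))"
      unfolding sum' cis_mult[symmetric] by (simp only: mult_ac)
    finally show "(\<integral>y. complex_of_real (star_dens (Suc p) \<sigma> s u (x(p := y))) * cis (\<Sum>i<Suc p. t i * (x(p := y)) i) \<partial>lborel)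
      = complex_of_real (exp (- (s\<^sup>2 * (t p)\<^sup>2) / 2)) *
       (complex_of_real (star_dens p \<sigma> s u x) * cis (\<Sum>i<p. t' i * x i))" .
  qed
  also have "\<dots> = complex_of_real (exp (- (s\<^sup>2 * (t p)\<^sup>2) / 2) *
     exp (- (\<sigma>\<^sup>2 * (t' 0 + (\<Sum>j=1..<p. u j * t' j))\<^sup>2 + s\<^sup>2 * (\<Sum>j=1..<p. (t' j)\<^sup>2)) / 2))"
    by (subst integral_mult_right_zero) (simp only: step.IH of_real_mult)
  also have "exp (- (s\<^sup>2 * (t p)\<^sup>2) / 2) *
     exp (- (\<sigma>\<^sup>2 * (t' 0 + (\<Sum>j=1..<p. u j * t' j))\<^sup>2 + s\<^sup>2 * (\<Sum>j=1..<p. (t' j)\<^sup>2)) / 2)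
    = exp (- (\<sigma>\<^sup>2 * (t 0 + (\<Sum>j=1..<Suc p. u j * t j))\<^sup>2 + s\<^sup>2 * (\<Sum>j=1..<Suc p. (t j)\<^sup>2)) / 2)"
  proof -
    have e: "{1..<Suc p} = insert p {1..<p}" using step.hyps by auto
    have "(\<Sum>j=1..<p. u j * t' j) = (\<Sum>j=1..<p. u j * t j)" "(\<Sum>j=1..<p. (t' j)\<^sup>2) = (\<Sum>j=1..<p. (t j)\<^sup>2)"
      by (auto intro!: sum.cong simp: t'_def)
    moreover have "t' 0 = t 0 + u p * t p" by (simp add: t'_def)
    ultimately show ?thesis
      unfolding e by (simp add: algebra_simps add_divide_distrib diff_divide_distrib flip: exp_add)
  qed
  finally show ?case .
qed

text \<open>The rank-one part contributes the square of a linear form. The result is the exponent of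
  \<open>integral_cis_star_dens\<close>, and it is visibly nonnegative.\<close>

lemma star_cov_quadratic_form:
  assumes "1 \<le> p"
  shows "(\<Sum>i<p. \<Sum>j<p. t i * star_cov \<sigma> s u i j * t j)
    = \<sigma>\<^sup>2 * (t 0 + (\<Sum>j=1..<p. u j * t j))\<^sup>2 + s\<^sup>2 * (\<Sum>j=1..<p. (t j)\<^sup>2)"
proof -
  define v where "v i = (if i = 0 then 1 else u i)" for i
  have e: "{..<p} = insert 0 {1..<p}" using assms by auto
  have v: "(\<Sum>i<p. v i * t i) = t 0 + (\<Sum>j=1..<p. u j * t j)"
    unfolding e by (simp add: v_def)
  have "(\<Sum>i<p. \<Sum>j<p. t i * star_cov \<sigma> s u i j * t j)
    = (\<Sum>i<p. \<Sum>j<p. \<sigma>\<^sup>2 * ((v i * t i) * (v j * t j)) + (if j = i then (if 1 \<le> i then s\<^sup>2 * (t i)\<^sup>2 else 0) else 0))"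
    by (intro sum.cong) (auto simp: star_cov_def v_def algebra_simps power2_eq_square)
  also have "\<dots> = \<sigma>\<^sup>2 * (\<Sum>i<p. v i * t i)\<^sup>2 + (\<Sum>i<p. if 1 \<le> i then s\<^sup>2 * (t i)\<^sup>2 else 0)"
    by (simp add: sum.distrib power2_eq_square sum_product flip: sum_distrib_left)
  also have "(\<Sum>i<p. if 1 \<le> i then s\<^sup>2 * (t i)\<^sup>2 else 0) = s\<^sup>2 * (\<Sum>j=1..<p. (t j)\<^sup>2)"
    unfolding e by (simp add: sum_distrib_left)
  finally show ?thesis by (simp add: v)
qed

lemma gaussian_star_law:
  assumes "1 \<le> p" "0 < s" "0 < \<sigma>"
  shows "gaussian p (star_cov \<sigma> s u) (star_law p \<sigma> s u)"
proof -
  note measurable_Rp_component [measurable]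
  have "(\<integral>x. cis (\<Sum>i<p. t i * x i) \<partial>star_law p \<sigma> s u)
      = complex_of_real (exp (- (\<Sum>i<p. \<Sum>j<p. t i * star_cov \<sigma> s u i j * t j) / 2))" for t
  proof -
    have "(\<integral>x. cis (\<Sum>i<p. t i * x i) \<partial>star_law p \<sigma> s u)
      = (\<integral>x. star_dens p \<sigma> s u x *\<^sub>R cis (\<Sum>i<p. t i * x i) \<partial>Rp p)"
      unfolding star_law_def using assms by (intro integral_density) (auto simp: star_dens_nonneg)
    then show ?thesis
      using integral_cis_star_dens[OF assms, of u t] star_cov_quadratic_form[OF assms(1), of t \<sigma> s u]
      by (simp add: scaleR_conv_of_real)
  qed
  then show ?thesis
    by (simp add: gaussian_def prob_space_star_law[OF assms] sets_star_law)
qed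

subsection \<open>The spectral norm\<close>

lemma euclid_norm_nonneg: "0 \<le> euclid_norm p x"
  by (simp add: euclid_norm_def sum_nonneg)

lemma euclid_norm_scale: "euclid_norm p (\<lambda>i. c * x i) = \<bar>c\<bar> * euclid_norm p x"
  by (simp add: euclid_norm_def power_mult_distrib real_sqrt_mult flip: sum_distrib_left)

lemma mat_vec_scale: "mat_vec p A (\<lambda>i. c * x i) = (\<lambda>i. c * mat_vec p A x i)"
  by (simp add: mat_vec_def sum_distrib_left mult_ac)

lemma abs_le_euclid_norm: "i < p \<Longrightarrow> \<bar>x i\<bar> \<le> euclid_norm p x"
  unfolding euclid_norm_def
  by (rule real_le_rsqrt) (auto intro: member_le_sum)

text \<open>The real \<open>Sup\<close> in \<open>spec_norm\<close> dominates the members of its set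
  only if that set is bounded; absolute row sums bound the coordinates of the image of the unit
  ball.\<close>

lemma spec_norm_bdd_above: "bdd_above {euclid_norm p (mat_vec p A x) | x. euclid_norm p x \<le> 1}"
proof (rule bdd_aboveI, clarify)
  fix x assume x: "euclid_norm p x \<le> 1"
  have "\<bar>mat_vec p A x i\<bar> \<le> (\<Sum>j<p. \<bar>A i j\<bar>)" for i
  proof -
    have "\<bar>mat_vec p A x i\<bar> \<le> (\<Sum>j<p. \<bar>A i j\<bar> * \<bar>x j\<bar>)"
      unfolding mat_vec_def by (rule order.trans[OF sum_abs]) (simp add: abs_mult)
    also have "\<dots> \<le> (\<Sum>j<p. \<bar>A i j\<bar> * 1)"
      using abs_le_euclid_norm[of _ p x] x by (intro sum_mono mult_left_mono) (auto intro: order.trans)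
    finally show ?thesis by simp
  qed
  then show "euclid_norm p (mat_vec p A x) \<le> sqrt (\<Sum>i<p. (\<Sum>j<p. \<bar>A i j\<bar>)\<^sup>2)"
    unfolding euclid_norm_def by (intro real_sqrt_le_mono sum_mono) (auto simp: abs_le_square_iff[symmetric] sum_nonneg)
qed

lemma euclid_norm_mat_vec_le_spec_norm:
  "euclid_norm p x \<le> 1 \<Longrightarrow> euclid_norm p (mat_vec p A x) \<le> spec_norm p A"
  unfolding spec_norm_def by (rule cSup_upper[OF _ spec_norm_bdd_above]) blast

lemma column_le_spec_norm:
  assumes "k < p"
  shows "sqrt (\<Sum>i<p. (A i k)\<^sup>2) \<le> spec_norm p A"
proof -
  \<comment> \<open>The matrix maps the unit vector \<open>e\<close> to its column
    \<open>k\<close>.\<close>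
  define e where "e i = (if i = k then 1 else 0 :: real)" for i
  have "euclid_norm p e \<le> 1"
    using assms by (simp add: euclid_norm_def e_def if_distrib[where f = "\<lambda>x. x\<^sup>2"] cong: if_cong)
  from euclid_norm_mat_vec_le_spec_norm[OF this, of A]
  show ?thesis using assms by (simp add: euclid_norm_def mat_vec_def e_def if_distrib cong: if_cong)
qed

lemma entry_le_spec_norm:
  assumes "i < p" "k < p"
  shows "\<bar>A i k\<bar> \<le> spec_norm p A"
  using abs_le_euclid_norm[OF assms(1), of "\<lambda>i. A i k"] column_le_spec_norm[OF assms(2), of A]
  by (simp add: euclid_norm_def)

section \<open>Measurability of the spectral norm\<close>

lemma rational_approximation:
  fixes x :: "nat \<Rightarrow> real"
  shows "\<exists>q. (\<forall>m. q m \<in> {..<p} \<rightarrow>\<^sub>E \<rat>) \<and> (\<forall>i<p. (\<lambda>m. q m i) \<longlonglongrightarrow> x i)"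
proof -
  have "\<exists>r\<in>\<rat>. x i - 1 / real (Suc m) < r \<and> r < x i" for i m
    using Rats_dense_in_real[of "x i - 1 / real (Suc m)" "x i"] by auto
  then obtain r where r: "\<And>i m. r i m \<in> \<rat>" "\<And>i m. x i - 1 / real (Suc m) < r i m" "\<And>i m. r i m < x i"
    by metis
  have "(\<lambda>m. r i m) \<longlonglongrightarrow> x i" for i
  proof (rule tendsto_sandwich)
    have "(\<lambda>m. x i - 1 / real (Suc m)) \<longlonglongrightarrow> x i - 0"
      by (intro tendsto_diff tendsto_const LIMSEQ_Suc lim_1_over_n)
    then show "(\<lambda>m. x i - 1 / real (Suc m)) \<longlonglongrightarrow> x i" by simp
  qed (use r in \<open>auto intro!: always_eventually less_imp_le simp del: of_nat_Suc\<close>)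
  then show ?thesis
    \<comment> \<open>Restriction puts the approximants into the extensional function space, which
      is countable for rational values.\<close>
    by (intro exI[of _ "\<lambda>m. restrict (\<lambda>i. r i m) {..<p}"]) (auto simp: r(1))
qed

text \<open>Testing against rational vectors only makes the supremum countable, hence measurable.\<close>
lemma spec_norm_le_iff:
  "spec_norm p A \<le> r \<longleftrightarrow>
    0 \<le> r \<and> (\<forall>q\<in>{..<p} \<rightarrow>\<^sub>E (\<rat> :: real set). euclid_norm p (mat_vec p A q) \<le> r * euclid_norm p q)"
proof safe
  assume le: "spec_norm p A \<le> r"
  have "0 \<le> spec_norm p A"
    using euclid_norm_mat_vec_le_spec_norm[of p "\<lambda>_. 0" A]
    by (simp add: euclid_norm_def mat_vec_def)
  with le show "0 \<le> r" by simp
  fix q assume "q \<in> {..<p} \<rightarrow>\<^sub>E (\<rat> :: real set)"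
  show "euclid_norm p (mat_vec p A q) \<le> r * euclid_norm p q"
  \<comment> \<open>A vector of norm zero cannot be normalised, but its coordinates vanish and so do
    both sides.\<close>
  proof (cases "euclid_norm p q = 0")
    case True
    then have "\<bar>q i\<bar> \<le> 0" if "i < p" for i using abs_le_euclid_norm[OF that, of q] by simp
    then show ?thesis using True by (simp add: euclid_norm_def mat_vec_def)
  next
    case False
    define c where "c = 1 / euclid_norm p q"
    have c: "0 < c" using False euclid_norm_nonneg[of p q] by (simp add: c_def)
    have "euclid_norm p (\<lambda>i. c * q i) \<le> 1" using False c by (simp add: euclid_norm_scale) (simp add: c_def)
    from euclid_norm_mat_vec_le_spec_norm[OF this, of A]
    have "c * euclid_norm p (mat_vec p A q) \<le> r"
      using le c by (simp add: mat_vec_scale euclid_norm_scale)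
    then show ?thesis using c False euclid_norm_nonneg[of p q] by (simp add: c_def field_simps)
  qed
next
  assume r: "0 \<le> r" and le: "\<forall>q\<in>{..<p} \<rightarrow>\<^sub>E (\<rat> :: real set). euclid_norm p (mat_vec p A q) \<le> r * euclid_norm p q"
  show "spec_norm p A \<le> r"
    unfolding spec_norm_def
  proof (rule cSup_least)
    show "{euclid_norm p (mat_vec p A x) |x. euclid_norm p x \<le> 1} \<noteq> {}"
      by (auto intro!: exI[of _ "\<lambda>_. 0"] simp: euclid_norm_def)
  next
    fix y assume "y \<in> {euclid_norm p (mat_vec p A x) |x. euclid_norm p x \<le> 1}"
    then obtain x where y: "y = euclid_norm p (mat_vec p A x)" and x: "euclid_norm p x \<le> 1" by blast
    obtain q where q: "\<And>m. q m \<in> {..<p} \<rightarrow>\<^sub>E \<rat>" "\<And>i. i < p \<Longrightarrow> (\<lambda>m. q m i) \<longlonglongrightarrow> x i"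
      using rational_approximation[of p x] by blast
    have "(\<lambda>m. euclid_norm p (mat_vec p A (q m))) \<longlonglongrightarrow> euclid_norm p (mat_vec p A x)"
      unfolding euclid_norm_def mat_vec_def by (intro tendsto_intros q(2)) auto
    moreover have "(\<lambda>m. r * euclid_norm p (q m)) \<longlonglongrightarrow> r * euclid_norm p x"
      unfolding euclid_norm_def by (intro tendsto_intros q(2)) auto
    ultimately have "euclid_norm p (mat_vec p A x) \<le> r * euclid_norm p x"
      using le q(1) by (auto intro: LIMSEQ_le)
    also have "\<dots> \<le> r" using r x by (simp add: mult_left_le)
    finally show "y \<le> r" by (simp add: y)
  qed
qed

lemma borel_measurable_spec_norm:
  assumes A: "\<And>i j. i < p \<Longrightarrow> j < p \<Longrightarrow> (\<lambda>X. A X i j) \<in> borel_measurable M"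
  shows "(\<lambda>X. spec_norm p (A X)) \<in> borel_measurable M"
  unfolding borel_measurable_iff_le
proof
  fix r
  have [measurable]: "countable ({..<p} \<rightarrow>\<^sub>E (\<rat> :: real set))"
    by (intro countable_PiE) (auto simp: countable_rat)
  have [measurable]: "(\<lambda>X. euclid_norm p (mat_vec p (A X) q)) \<in> borel_measurable M" for q
    unfolding euclid_norm_def mat_vec_def using A by measurable
  show "{X \<in> space M. spec_norm p (A X) \<le> r} \<in> sets M"
    unfolding spec_norm_le_iff by measurable
qed

subsection \<open>Spectrum of the star-shaped covariance\<close>

lemma star_cov_col0: "star_cov \<sigma> s u i 0 = \<sigma>\<^sup>2 * (if i = 0 then 1 else u i)"
  by (simp add: star_cov_def)

lemma mat_vec_star_cov:
  assumes p: "1 \<le> p" and i: "i < p"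
  shows "mat_vec p (star_cov \<sigma> s u) v i =
    \<sigma>\<^sup>2 * (if i = 0 then 1 else u i) * (v 0 + (\<Sum>j=1..<p. u j * v j)) + (if i = 0 then 0 else s\<^sup>2 * v i)"
proof -
  have e: "{..<p} = insert 0 {1..<p}" using p by auto
  have "mat_vec p (star_cov \<sigma> s u) v i =
    (\<Sum>j<p. \<sigma>\<^sup>2 * (if i = 0 then 1 else u i) * ((if j = 0 then 1 else u j) * v j)
       + (if j = i then (if i = 0 then 0 else s\<^sup>2 * v i) else 0))"
    unfolding mat_vec_def by (intro sum.cong) (auto simp: star_cov_def algebra_simps)
  also have "\<dots> = \<sigma>\<^sup>2 * (if i = 0 then 1 else u i) * (\<Sum>j<p. (if j = 0 then 1 else u j) * v j)
       + (if i = 0 then 0 else s\<^sup>2 * v i)"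
    using i by (simp add: sum.distrib flip: sum_distrib_left)
  also have "(\<Sum>j<p. (if j = 0 then 1 else u j) * v j) = v 0 + (\<Sum>j=1..<p. u j * v j)"
    unfolding e by simp
  finally show ?thesis .
qed

text \<open>\<open>lambda_max\<close> and \<open>lambda_min\<close> are meaningful only if the set of eigenvalues is finite and
  nonempty. For \<open>star_cov\<close> both follow from the explicit characteristic equation.\<close>
lemma eigenvalue_star_cov:
  assumes p: "1 \<le> p" and ev: "is_eigenvalue p (star_cov \<sigma> s u) l"
  defines "q \<equiv> \<Sum>j=1..<p. (u j)\<^sup>2"
  shows "l = s\<^sup>2 \<or> (l - s\<^sup>2) * (l - \<sigma>\<^sup>2) = \<sigma>\<^sup>2 * q * l"
proof (rule disjCI)
  assume ne: "(l - s\<^sup>2) * (l - \<sigma>\<^sup>2) \<noteq> \<sigma>\<^sup>2 * q * l"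
  obtain v where v: "\<exists>i<p. v i \<noteq> 0" "\<And>i. i < p \<Longrightarrow> mat_vec p (star_cov \<sigma> s u) v i = l * v i"
    using ev by (auto simp: is_eigenvalue_def)
  define S where "S = v 0 + (\<Sum>j=1..<p. u j * v j)"
  have v0: "\<sigma>\<^sup>2 * S = l * v 0" using v(2)[of 0] p by (simp add: mat_vec_star_cov S_def)
  \<comment> \<open>Row \<open>i\<close> determines \<open>(l - s\<^sup>2) * v i\<close> from
    \<open>v 0\<close>. Multiplying \<open>S\<close> by \<open>l - s\<^sup>2\<close> therefore
    eliminates every coordinate but \<open>v 0\<close>.\<close>
  have vi: "(l - s\<^sup>2) * v i = u i * (l * v 0)" if "i < p" "i \<noteq> 0" for i
  proof -
    have "\<sigma>\<^sup>2 * u i * S + s\<^sup>2 * v i = l * v i"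
      using v(2)[of i] p that by (simp add: mat_vec_star_cov S_def)
    then show ?thesis unfolding v0[symmetric] by (simp add: algebra_simps)
  qed
  have "(l - s\<^sup>2) * (\<sigma>\<^sup>2 * S) = \<sigma>\<^sup>2 * ((l - s\<^sup>2) * v 0 + (\<Sum>j=1..<p. u j * ((l - s\<^sup>2) * v j)))"
    by (simp add: S_def algebra_simps sum_distrib_left)
  also have "(\<Sum>j=1..<p. u j * ((l - s\<^sup>2) * v j)) = (\<Sum>j=1..<p. (u j)\<^sup>2 * (l * v 0))"
    by (intro sum.cong refl) (subst vi, auto simp: power2_eq_square)
  also have "\<dots> = q * (l * v 0)" by (simp add: q_def sum_distrib_right)
  finally have "((l - s\<^sup>2) * (l - \<sigma>\<^sup>2) - \<sigma>\<^sup>2 * q * l) * v 0 = 0"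
    unfolding v0 by (simp add: algebra_simps)
  \<comment> \<open>With \<open>v 0 = 0\<close>, a nonzero coordinate elsewhere forces
    \<open>l = s\<^sup>2\<close> through its own row.\<close>
  then have z: "v 0 = 0" using ne by simp
  then obtain i where "i < p" "v i \<noteq> 0" "i \<noteq> 0" using v(1) by metis
  then show "l = s\<^sup>2" using vi[of i] z by simp
qed

text \<open>A root \<open>l\<close> of the characteristic equation other than
  \<open>s\<^sup>2\<close> has the eigenvector with entries \<open>l - s\<^sup>2\<close> and
  \<open>l * u i\<close>. This vector may vanish at \<open>l = s\<^sup>2\<close>, so the case
  without other roots is treated separately.\<close>

lemma ex_eigenvalue_star_cov:
  assumes p: "1 \<le> p"
  shows "\<exists>l. is_eigenvalue p (star_cov \<sigma> s u) l"
proof (cases "\<exists>l. l \<noteq> s\<^sup>2 \<and> (l - s\<^sup>2) * (l - \<sigma>\<^sup>2) = \<sigma>\<^sup>2 * (\<Sum>j=1..<p. (u j)\<^sup>2) * l")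
  case True
  define q where "q = (\<Sum>j=1..<p. (u j)\<^sup>2)"
  obtain l where l: "l \<noteq> s\<^sup>2" "(l - s\<^sup>2) * (l - \<sigma>\<^sup>2) = \<sigma>\<^sup>2 * q * l" using True by (auto simp: q_def)
  define v where "v i = (if i = 0 then l - s\<^sup>2 else l * u i)" for i
  have S: "(\<Sum>j=1..<p. u j * v j) = l * q"
    by (simp add: v_def q_def sum_distrib_left power2_eq_square mult_ac)
  have "mat_vec p (star_cov \<sigma> s u) v i = l * v i" if i: "i < p" for i
  proof -
    have key: "\<sigma>\<^sup>2 * (l - s\<^sup>2 + l * q) = l * (l - s\<^sup>2)" using l(2) by (simp add: algebra_simps)
    have "mat_vec p (star_cov \<sigma> s u) v i
      = (if i = 0 then 1 else u i) * (\<sigma>\<^sup>2 * (l - s\<^sup>2 + l * q)) + (if i = 0 then 0 else s\<^sup>2 * v i)"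
      unfolding mat_vec_star_cov[OF p i] S by (simp add: v_def)
    also have "\<dots> = l * v i" unfolding key by (simp add: v_def algebra_simps)
    finally show ?thesis .
  qed
  moreover have "v 0 \<noteq> 0" "0 < p" using l(1) p by (simp_all add: v_def)
  ultimately show ?thesis unfolding is_eigenvalue_def by blast
next
  case False
  define q where "q = (\<Sum>j=1..<p. (u j)\<^sup>2)"
  define b where "b = s\<^sup>2 + \<sigma>\<^sup>2 + \<sigma>\<^sup>2 * q"
  have q0: "0 \<le> q" by (simp add: q_def sum_nonneg)
  \<comment> \<open>The discriminant is a sum of nonnegative terms, so the quadratic has a real
    root. By \<open>False\<close> that root is \<open>s\<^sup>2\<close>, which leaves
    \<open>\<sigma>\<^sup>2 * q * s\<^sup>2 = 0\<close>.\<close>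
  have "0 \<le> (s\<^sup>2 - \<sigma>\<^sup>2)\<^sup>2 + (\<sigma>\<^sup>2 * q) * (\<sigma>\<^sup>2 * q + 2 * s\<^sup>2 + 2 * \<sigma>\<^sup>2)"
    using q0 by (intro add_nonneg_nonneg mult_nonneg_nonneg) auto
  also have "\<dots> = b\<^sup>2 - 4 * (s\<^sup>2 * \<sigma>\<^sup>2)" by (simp add: b_def power2_eq_square algebra_simps)
  finally have disc: "0 \<le> b\<^sup>2 - 4 * (s\<^sup>2 * \<sigma>\<^sup>2)" .
  define l where "l = (b + sqrt (b\<^sup>2 - 4 * (s\<^sup>2 * \<sigma>\<^sup>2))) / 2"
  have "2 * l - b = sqrt (b\<^sup>2 - 4 * (s\<^sup>2 * \<sigma>\<^sup>2))" unfolding l_def by (simp add: field_simps)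
  then have "(2 * l - b)\<^sup>2 = b\<^sup>2 - 4 * (s\<^sup>2 * \<sigma>\<^sup>2)" using disc by simp
  then have "(l - s\<^sup>2) * (l - \<sigma>\<^sup>2) = \<sigma>\<^sup>2 * q * l"
    by (simp add: b_def power2_eq_square algebra_simps)
  moreover from this have "l = s\<^sup>2" using False by (auto simp: q_def)
  ultimately have "\<sigma>\<^sup>2 * q * s\<^sup>2 = 0" by simp
  then consider "\<sigma> = 0" | "s = 0" "\<sigma> \<noteq> 0" | "q = 0" by auto
  then show ?thesis
  proof cases
    case 1
    then have "mat_vec p (star_cov \<sigma> s u) (\<lambda>i. if i = 0 then 1 else 0) i = 0 * (if i = 0 then 1 else 0)" if "i < p" for i
      using mat_vec_star_cov[OF p that, of \<sigma> s u "\<lambda>i. if i = 0 then 1 else 0"] by simp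
    then show ?thesis using p unfolding is_eigenvalue_def
      by (intro exI[of _ 0] exI[of _ "\<lambda>i. if i = 0 then 1 else 0"]) auto
  next
    case 2
    \<comment> \<open>This is the nonzero eigenvalue of the rank-one matrix left when
      \<open>s = 0\<close>; it contradicts \<open>False\<close>. In the other two cases the first
      unit vector is an eigenvector.\<close>
    define l' where "l' = \<sigma>\<^sup>2 * (1 + q)"
    have "1 + q \<noteq> 0" using q0 by simp
    then have "l' \<noteq> s\<^sup>2" using 2 by (simp add: l'_def)
    moreover have "(l' - s\<^sup>2) * (l' - \<sigma>\<^sup>2) = \<sigma>\<^sup>2 * q * l'"
      using 2 by (simp add: l'_def algebra_simps)
    ultimately show ?thesis using False unfolding q_def by blast
  next
    case 3
    then have "\<forall>j\<in>{1..<p}. u j = 0" by (simp add: q_def sum_nonneg_eq_0_iff)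
    then have "mat_vec p (star_cov \<sigma> s u) (\<lambda>i. if i = 0 then 1 else 0) i = \<sigma>\<^sup>2 * (if i = 0 then 1 else 0)" if "i < p" for i
      using mat_vec_star_cov[OF p that, of \<sigma> s u "\<lambda>i. if i = 0 then 1 else 0"] that by auto
    then show ?thesis using p unfolding is_eigenvalue_def
      by (intro exI[of _ "\<sigma>\<^sup>2"] exI[of _ "\<lambda>i. if i = 0 then 1 else 0"]) auto
  qed
qed

lemma finite_quadratic_roots:
  fixes a b c :: real
  shows "finite {l. (l - a) * (l - b) = c * l}"
proof -
  have "{l. (l - a) * (l - b) = c * l} = {l. poly [:a * b, - (a + b + c), 1:] l = 0}"
    by (auto simp: algebra_simps)
  then show ?thesis using poly_roots_finite[of "[:a * b, - (a + b + c), 1:]"] by simp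
qed

text \<open>\<open>a\<close> is the midpoint of the interval and \<open>d\<close> a quarter of its
  length, so \<open>s\<^sup>2\<close> and \<open>\<sigma>\<^sup>2\<close> stay at distance
  \<open>d\<close> from both ends. Outside the interval the product of the two factors in the
  characteristic equation is too large for the coupling term \<open>c * l\<close>.\<close>

lemma star_cov_in_Theta:
  assumes p: "1 \<le> p" and M: "0 < M1" "M1 < M2"
  defines "a \<equiv> (M1 + M2) / 2" and "d \<equiv> (M2 - M1) / 4"
  assumes s: "\<bar>s\<^sup>2 - a\<bar> \<le> d" and \<sigma>: "\<bar>\<sigma>\<^sup>2 - a\<bar> \<le> d"
    and q: "\<sigma>\<^sup>2 * (\<Sum>j=1..<p. (u j)\<^sup>2) < d\<^sup>2 / M2"
  shows "star_cov \<sigma> s u \<in> Theta M1 M2 p"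
proof -
  define c where "c = \<sigma>\<^sup>2 * (\<Sum>j=1..<p. (u j)\<^sup>2)"
  have c0: "0 \<le> c" by (simp add: c_def sum_nonneg)
  have c1: "c * M2 < d\<^sup>2" using q M by (simp add: c_def field_simps)
  have d0: "0 < d" using M by (simp add: d_def)
  have ad: "a - d = M1 + d" "a + d = M2 - d" by (simp_all add: a_def d_def field_simps)
  have sb: "M1 + d \<le> s\<^sup>2" "s\<^sup>2 \<le> M2 - d" and \<sigma>b: "M1 + d \<le> \<sigma>\<^sup>2" "\<sigma>\<^sup>2 \<le> M2 - d"
    using s \<sigma> unfolding ad[symmetric] by (auto simp: abs_le_iff)
  let ?E = "{l. is_eigenvalue p (star_cov \<sigma> s u) l}"
  have fin: "finite ?E"
    by (rule finite_subset[of _ "insert (s\<^sup>2) {l. (l - s\<^sup>2) * (l - \<sigma>\<^sup>2) = c * l}"])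
       (use eigenvalue_star_cov[OF p] finite_quadratic_roots in \<open>auto simp: c_def\<close>)
  have ne: "?E \<noteq> {}" using ex_eigenvalue_star_cov[OF p] by blast
  have bounds: "M1 \<le> l \<and> l \<le> M2" if "l \<in> ?E" for l
  proof -
    from that eigenvalue_star_cov[OF p, of \<sigma> s u l]
    consider "l = s\<^sup>2" | "(l - s\<^sup>2) * (l - \<sigma>\<^sup>2) = c * l" by (auto simp: c_def)
    then show ?thesis
    proof cases
      case 1
      then show ?thesis using sb d0 by simp
    next
      case 2
      have "\<not> M2 < l"
      proof
        assume l: "M2 < l"
        \<comment> \<open>At \<open>M2\<close> the product is at least \<open>d\<^sup>2\<close>,
          which exceeds \<open>c * M2\<close>. Beyond \<open>M2\<close> it grows at rate at least
          \<open>d\<close>, and \<open>c * l\<close> only at rate \<open>c \<le> d\<close>.\<close>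
        have "l - s\<^sup>2 \<ge> l - M2 + d" "l - \<sigma>\<^sup>2 \<ge> l - M2 + d"
          using sb \<sigma>b by auto
        then have "(l - s\<^sup>2) * (l - \<sigma>\<^sup>2) \<ge> (l - M2 + d) * (l - M2 + d)"
          using l d0 by (intro mult_mono) auto
        moreover have "(l - M2 + d) * (l - M2 + d) \<ge> (l - M2) * d + d\<^sup>2"
        proof -
          have "(l - M2 + d) * (l - M2 + d) = (l - M2) * d + d\<^sup>2 + (l - M2) * (l - M2 + d)"
            by (simp add: power2_eq_square algebra_simps)
          moreover have "0 \<le> (l - M2) * (l - M2 + d)" using l d0 by simp
          ultimately show ?thesis by linarith
        qed
        moreover have "c \<le> d"
        proof -
          have "c * M2 < d * M2"
            using c1 d0 M by (rule_tac order.strict_trans2[OF c1]) (auto simp: power2_eq_square d_def)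
          then show ?thesis using M by simp
        qed
        then have "(l - M2) * d \<ge> c * (l - M2)" using l by (simp add: mult.commute)
        ultimately have "(l - s\<^sup>2) * (l - \<sigma>\<^sup>2) > c * (l - M2) + c * M2" using c1 by linarith
        then show False using 2 by (simp add: algebra_simps)
      qed
      moreover have "\<not> l < M1"
      proof
        assume l: "l < M1"
        have "s\<^sup>2 - l \<ge> d" "\<sigma>\<^sup>2 - l \<ge> d"
          using sb \<sigma>b l d0 by auto
        then have "(s\<^sup>2 - l) * (\<sigma>\<^sup>2 - l) \<ge> d * d"
          using d0 by (intro mult_mono) auto
        moreover have "c * l \<le> c * M2" using l M c0 by (intro mult_left_mono) auto
        ultimately show False using 2 c1 by (simp add: power2_eq_square algebra_simps)
      qed
      ultimately show ?thesis by auto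
    qed
  qed
  have "psd p (star_cov \<sigma> s u)"
    unfolding psd_def star_cov_quadratic_form[OF p]
    by (auto simp: star_cov_def sum_nonneg mult_ac)
  moreover have "lambda_max p (star_cov \<sigma> s u) \<le> M2" "M1 \<le> lambda_min p (star_cov \<sigma> s u)"
    unfolding lambda_max_def lambda_min_def using fin ne bounds by (auto simp: Max_le_iff Min_ge_iff)
  ultimately show ?thesis by (simp add: Theta_def)
qed

subsection \<open>Hellinger affinity of neighbouring hypothesis laws\<close>

text \<open>The identity \<open>(y - m)\<^sup>2 + (y + m)\<^sup>2 = 2 * y\<^sup>2 + 2 *
  m\<^sup>2\<close> separates \<open>y\<close> from \<open>m\<close>.\<close>

lemma sqrt_normal_density_mult_uminus:
  assumes "0 < s"
  shows "sqrt (normal_density m s y * normal_density (- m) s y) = normal_density 0 s y * exp (- m\<^sup>2 / (2 * s\<^sup>2))"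
proof -
  have "normal_density m s y * normal_density (- m) s y = (normal_density 0 s y * exp (- m\<^sup>2 / (2 * s\<^sup>2)))\<^sup>2"
    using assms
    by (simp add: normal_density_def power_mult_distrib power_divide exp_double[symmetric] field_simps flip: exp_add)
       (simp add: power2_eq_square field_simps)
  then show ?thesis by (simp add: real_sqrt_abs)
qed

lemma normal_density_precision:
  assumes "0 < A" "0 < b"
  shows "normal_density 0 (sqrt (A / b)) y = sqrt b * (1 / sqrt (2 * pi * A)) * exp (- b * y\<^sup>2 / (2 * A))"
  using assms by (simp add: normal_density_def real_sqrt_divide real_sqrt_mult field_simps)

text \<open>The precisions \<open>(1 - t) / A\<close> and \<open>(1 + t) / A\<close> average to
  \<open>1 / A\<close>. The geometric mean of the two densities is therefore the density of
  \<open>N(0, A)\<close> times the fourth root of \<open>1 - t\<^sup>2\<close>, and that root is at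
  least \<open>1 - t\<^sup>2\<close>.\<close>

lemma sqrt_normal_density_mult_scale:
  assumes A: "0 < A" and t: "0 \<le> t" "t < 1"
  shows "(1 - t\<^sup>2) * normal_density 0 (sqrt A) y
    \<le> sqrt (normal_density 0 (sqrt (A / (1 - t))) y * normal_density 0 (sqrt (A / (1 + t))) y)"
proof (rule real_le_rsqrt)
  have t2: "t\<^sup>2 \<le> 1" using t by (simp add: power_le_one)
  define k where "k = 1 / sqrt (2 * pi * A)"
  have "((1 - t\<^sup>2) * normal_density 0 (sqrt A) y)\<^sup>2 = (1 - t\<^sup>2)\<^sup>2 * (k * exp (- y\<^sup>2 / (2 * A)))\<^sup>2"
    using normal_density_precision[OF A, of 1 y] by (simp add: power_mult_distrib power_divide k_def)
  also have "\<dots> \<le> sqrt (1 - t\<^sup>2) * (k * exp (- y\<^sup>2 / (2 * A)))\<^sup>2"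
  proof (rule mult_right_mono)
    have "(1 - t\<^sup>2)\<^sup>2 \<le> 1 - t\<^sup>2" using t2 by (simp add: power2_eq_square mult_left_le)
    also have "\<dots> \<le> sqrt (1 - t\<^sup>2)"
      using t2 by (intro real_le_rsqrt) (simp add: power2_eq_square mult_left_le)
    finally show "(1 - t\<^sup>2)\<^sup>2 \<le> sqrt (1 - t\<^sup>2)" .
  qed auto
  also have "(k * exp (- y\<^sup>2 / (2 * A)))\<^sup>2
      = (k * exp (- (1 - t) * y\<^sup>2 / (2 * A))) * (k * exp (- (1 + t) * y\<^sup>2 / (2 * A)))"
  proof -
    have "- y\<^sup>2 / (2 * A) + - y\<^sup>2 / (2 * A) = - (1 - t) * y\<^sup>2 / (2 * A) + - (1 + t) * y\<^sup>2 / (2 * A)"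
      by (simp add: algebra_simps add_divide_distrib diff_divide_distrib)
    then show ?thesis
      by (simp add: power2_eq_square flip: exp_add)
  qed
  also have "sqrt (1 - t\<^sup>2) = sqrt (1 - t) * sqrt (1 + t)"
    by (simp add: power2_eq_square algebra_simps flip: real_sqrt_mult)
  finally show "((1 - t\<^sup>2) * normal_density 0 (sqrt A) y)\<^sup>2
    \<le> normal_density 0 (sqrt (A / (1 - t))) y * normal_density 0 (sqrt (A / (1 + t))) y"
    using t A by (subst (1 2) normal_density_precision) (auto simp: k_def mult_ac)
qed

lemma has_bochner_integral_normal_density_square:
  "0 < \<sigma> \<Longrightarrow> has_bochner_integral lborel (\<lambda>y. normal_density 0 \<sigma> y * y\<^sup>2) (\<sigma>\<^sup>2)"
  using normal_moment_even[of \<sigma> 0 1] by (simp add: fact_2 power2_eq_square)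

text \<open>Bound the exponential below by \<open>1 - c * y\<^sup>2\<close> and use the second
  moment.\<close>

lemma nn_integral_normal_density_gauss_factor:
  assumes "0 < \<sigma>" "0 \<le> c"
  shows "ennreal (1 - c * \<sigma>\<^sup>2) \<le> (\<integral>\<^sup>+ y. ennreal (normal_density 0 \<sigma> y) * ennreal (exp (- c * y\<^sup>2)) \<partial>lborel)"
proof -
  have sq: "has_bochner_integral lborel (\<lambda>y. normal_density 0 \<sigma> y * y\<^sup>2) (\<sigma>\<^sup>2)"
    by (rule has_bochner_integral_normal_density_square) fact
  have int: "integrable lborel (\<lambda>y. normal_density 0 \<sigma> y * exp (- c * y\<^sup>2))"
    by (rule Bochner_Integration.integrable_bound[OF integrable_normal_density[OF assms(1), of 0]])
       (use assms in \<open>auto intro!: AE_I2 mult_left_le simp: abs_mult\<close>)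
  have "1 - c * \<sigma>\<^sup>2 = (\<integral>y. normal_density 0 \<sigma> y - c * (normal_density 0 \<sigma> y * y\<^sup>2) \<partial>lborel)"
    using sq assms by (simp add: has_bochner_integral_iff)
  also have "\<dots> \<le> (\<integral>y. normal_density 0 \<sigma> y * exp (- c * y\<^sup>2) \<partial>lborel)"
  proof (rule integral_mono)
    show "integrable lborel (\<lambda>y. normal_density 0 \<sigma> y - c * (normal_density 0 \<sigma> y * y\<^sup>2))"
      using sq assms by (simp add: has_bochner_integral_iff)
  next
    fix y
    have "normal_density 0 \<sigma> y * (1 + - c * y\<^sup>2) \<le> normal_density 0 \<sigma> y * exp (- c * y\<^sup>2)"
      by (intro mult_left_mono exp_ge_add_one_self) auto
    then show "normal_density 0 \<sigma> y - c * (normal_density 0 \<sigma> y * y\<^sup>2) \<le> normal_density 0 \<sigma> y * exp (- c * y\<^sup>2)"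
      by (simp add: algebra_simps)
  qed (rule int)
  also have "ennreal \<dots> = (\<integral>\<^sup>+ y. ennreal (normal_density 0 \<sigma> y) * ennreal (exp (- c * y\<^sup>2)) \<partial>lborel)"
    using int by (subst nn_integral_eq_integral[symmetric]) (auto simp: ennreal_mult)
  finally show ?thesis by (simp add: ennreal_leI)
qed

text \<open>Only the factor of coordinate \<open>j\<close> changes. The geometric mean of its two
  versions is centred, up to a Gaussian factor in \<open>x 0\<close> alone.\<close>

lemma sqrt_star_dens_flip_coupling:
  assumes j: "1 \<le> j" "j < p" and s: "0 < s"
  shows "sqrt (star_dens p \<sigma> s u x * star_dens p \<sigma> s (u(j := - u j)) x)
    = star_dens p \<sigma> s (u(j := 0)) x * exp (- ((u j)\<^sup>2 / (2 * s\<^sup>2)) * (x 0)\<^sup>2)"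
proof -
  define R where "R = normal_density 0 \<sigma> (x 0) * (\<Prod>i\<in>{1..<p} - {j}. normal_density (u i * x 0) s (x i))"
  have split: "star_dens p \<sigma> s (u(j := c)) x = R * normal_density (c * x 0) s (x j)" for c
    unfolding star_dens_def R_def using j
    by (subst prod.remove[of _ j]) auto
  have "star_dens p \<sigma> s u x = R * normal_density (u j * x 0) s (x j)"
    using split[of "u j"] by simp
  moreover have "0 \<le> R" by (simp add: R_def prod_nonneg)
  ultimately have "sqrt (star_dens p \<sigma> s u x * star_dens p \<sigma> s (u(j := - u j)) x)
      = R * sqrt (normal_density (u j * x 0) s (x j) * normal_density (- (u j * x 0)) s (x j))"
    by (simp add: split real_sqrt_mult)
  then show ?thesis
    by (simp add: sqrt_normal_density_mult_uminus[OF s] split power_mult_distrib)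
qed

text \<open>The sign \<open>v 0\<close> perturbs the precision of coordinate 0 rather than its
  variance, so that opposite signs average out exactly in
  \<open>sqrt_normal_density_mult_scale\<close>.\<close>

definition hyper_dens :: "nat \<Rightarrow> real \<Rightarrow> real \<Rightarrow> (nat \<Rightarrow> real) \<Rightarrow> (nat \<Rightarrow> real) \<Rightarrow> real" where
  "hyper_dens p A t v = star_dens p (sqrt (A / (1 - v 0 * t))) (sqrt A) (\<lambda>j. t * v j)"

lemma hyper_dens_affinity:
  assumes p: "1 \<le> p" and A: "0 < A" and t: "0 < t" "t \<le> 1/2"
    and v: "v \<in> sign_cube p" and j: "j < p"
  shows "ennreal (1 - t\<^sup>2) \<le> (\<integral>\<^sup>+ x. ennreal (sqrt (hyper_dens p A t v x * hyper_dens p A t (flip_at j v) x)) \<partial>Rp p)"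
proof (cases "j = 0")
  case True
  have v0: "v 0 = 1 \<or> v 0 = -1" using v p by (auto simp: sign_cube_def PiE_iff)
  have t2: "t\<^sup>2 \<le> 1" using t by (simp add: power_le_one)
  define R where "R x = (\<Prod>i\<in>{1..<p}. normal_density (t * v i * x 0) (sqrt A) (x i))" for x
  have R0: "0 \<le> R x" for x by (simp add: R_def prod_nonneg)
  have h1: "hyper_dens p A t v x = normal_density 0 (sqrt (A / (1 - v 0 * t))) (x 0) * R x" for x
    by (simp add: hyper_dens_def star_dens_def R_def)
  have h2: "hyper_dens p A t (flip_at 0 v) x = normal_density 0 (sqrt (A / (1 + v 0 * t))) (x 0) * R x" for x
    by (simp add: hyper_dens_def star_dens_def R_def flip_at_def)
  have "(1 - t\<^sup>2) * star_dens p (sqrt A) (sqrt A) (\<lambda>j. t * v j) x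
      \<le> sqrt (hyper_dens p A t v x * hyper_dens p A t (flip_at 0 v) x)" for x
  proof -
    have "(1 - t\<^sup>2) * star_dens p (sqrt A) (sqrt A) (\<lambda>j. t * v j) x
      = ((1 - t\<^sup>2) * normal_density 0 (sqrt A) (x 0)) * R x"
      by (simp add: star_dens_def R_def)
    also have "\<dots> \<le> sqrt (normal_density 0 (sqrt (A / (1 - v 0 * t))) (x 0) * normal_density 0 (sqrt (A / (1 + v 0 * t))) (x 0)) * R x"
      using v0 sqrt_normal_density_mult_scale[OF A, of t "x 0"] t R0
      by (intro mult_right_mono) (auto simp: mult.commute)
    also have "\<dots> = sqrt (hyper_dens p A t v x * hyper_dens p A t (flip_at 0 v) x)"
      using R0[of x] by (simp add: h1 h2 real_sqrt_mult)
    finally show ?thesis .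
  qed
  then have "(\<integral>\<^sup>+ x. ennreal (1 - t\<^sup>2) * ennreal (star_dens p (sqrt A) (sqrt A) (\<lambda>j. t * v j) x) \<partial>Rp p)
     \<le> (\<integral>\<^sup>+ x. ennreal (sqrt (hyper_dens p A t v x * hyper_dens p A t (flip_at 0 v) x)) \<partial>Rp p)"
    using t2 by (intro nn_integral_mono) (auto simp: star_dens_nonneg simp flip: ennreal_mult intro!: ennreal_leI)
  then show ?thesis
    using p A True by (simp add: nn_integral_cmult nn_integral_star_dens_1)
next
  case False
  define \<sigma> where "\<sigma> = sqrt (A / (1 - v 0 * t))"
  have v0: "v 0 = 1 \<or> v 0 = -1" using v p by (auto simp: sign_cube_def PiE_iff)
  have "v j = 1 \<or> v j = -1" using v j by (auto simp: sign_cube_def PiE_iff)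
  then have vj: "(v j)\<^sup>2 = 1" by auto
  have \<sigma>: "0 < \<sigma>" using v0 t A by (auto simp: \<sigma>_def)
  \<comment> \<open>Since \<open>t \<le> 1/2\<close>. The factor 2 cancels the one in the exponent
    \<open>t\<^sup>2 / (2 * A)\<close>, leaving exactly \<open>1 - t\<^sup>2\<close>.\<close>
  have "\<sigma>\<^sup>2 \<le> 2 * A" using v0 t A by (auto simp: \<sigma>_def field_simps)
  then have "t\<^sup>2 / (2 * A) * \<sigma>\<^sup>2 \<le> t\<^sup>2 / (2 * A) * (2 * A)"
    using A by (intro mult_left_mono) auto
  then have "1 - t\<^sup>2 \<le> 1 - t\<^sup>2 / (2 * A) * \<sigma>\<^sup>2" using A by simp
  then have "ennreal (1 - t\<^sup>2) \<le> ennreal (1 - t\<^sup>2 / (2 * A) * \<sigma>\<^sup>2)" by (rule ennreal_leI)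
  also have "\<dots> \<le> (\<integral>\<^sup>+ y. ennreal (normal_density 0 \<sigma> y) * ennreal (exp (- (t\<^sup>2 / (2 * A)) * y\<^sup>2)) \<partial>lborel)"
    using \<sigma> A by (intro nn_integral_normal_density_gauss_factor) auto
  also have "\<dots> = (\<integral>\<^sup>+ x. ennreal (star_dens p \<sigma> (sqrt A) ((\<lambda>j. t * v j)(j := 0)) x) * ennreal (exp (- (t\<^sup>2 / (2 * A)) * (x 0)\<^sup>2)) \<partial>Rp p)"
    using p A by (subst nn_integral_star_dens) auto
  also have "\<dots> = (\<integral>\<^sup>+ x. ennreal (sqrt (hyper_dens p A t v x * hyper_dens p A t (flip_at j v) x)) \<partial>Rp p)"
  proof (rule nn_integral_cong)
    fix x
    have flip: "hyper_dens p A t (flip_at j v) = star_dens p \<sigma> (sqrt A) ((\<lambda>j. t * v j)(j := - (t * v j)))"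
      using False by (auto simp: hyper_dens_def flip_at_def \<sigma>_def intro!: arg_cong[where f = "star_dens p _ (sqrt A)"])
    show "ennreal (star_dens p \<sigma> (sqrt A) ((\<lambda>j. t * v j)(j := 0)) x) * ennreal (exp (- (t\<^sup>2 / (2 * A)) * (x 0)\<^sup>2))
      = ennreal (sqrt (hyper_dens p A t v x * hyper_dens p A t (flip_at j v) x))"
      unfolding flip
      using sqrt_star_dens_flip_coupling[of j p "sqrt A" \<sigma> "\<lambda>j. t * v j" x] False j A vj
      by (simp add: hyper_dens_def \<sigma>_def power_mult_distrib ennreal_mult star_dens_nonneg)
  qed
  finally show ?thesis .
qed

subsection \<open>Rescaling one coordinate\<close>

text \<open>The joint law of \<open>(T X, X)\<close> is a coupling, and its cost bounds the
  infimum.\<close>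

lemma wasserstein1_distr_le:
  assumes P: "prob_space P" "sets P = sets (Rp p)" and T: "T \<in> measurable (Rp p) (Rp p)"
  shows "wasserstein1 p (distr P (Rp p) T) P \<le> (\<integral>\<^sup>+ x. ennreal (euclid_norm p (\<lambda>i. T x i - x i)) \<partial>P)"
proof -
  interpret P: prob_space P by fact
  note measurable_Rp_component [measurable]
  have [measurable]: "T \<in> measurable P (Rp p)" "(\<lambda>x. x) \<in> measurable P (Rp p)"
    using T P(2) by (auto cong: measurable_cong_sets)
  have TT [measurable]: "(\<lambda>x. (T x, x)) \<in> measurable P (Rp p \<Otimes>\<^sub>M Rp p)" by measurable
  have "distr P (Rp p \<Otimes>\<^sub>M Rp p) (\<lambda>x. (T x, x)) \<in> couplings p (distr P (Rp p) T) P"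
    unfolding couplings_def using P(2)
    by (auto simp: P.prob_space_distr distr_distr comp_def distr_id2)
  then have "wasserstein1 p (distr P (Rp p) T) P
    \<le> (\<integral>\<^sup>+ z. ennreal (euclid_norm p (\<lambda>i. fst z i - snd z i)) \<partial>distr P (Rp p \<Otimes>\<^sub>M Rp p) (\<lambda>x. (T x, x)))"
    unfolding wasserstein1_def by (rule INF_lower)
  also have "\<dots> = (\<integral>\<^sup>+ x. ennreal (euclid_norm p (\<lambda>i. T x i - x i)) \<partial>P)"
  proof -
    have "(\<lambda>z. ennreal (euclid_norm p (\<lambda>i. fst z i - snd z i))) \<in> borel_measurable (Rp p \<Otimes>\<^sub>M Rp p)"
      unfolding euclid_norm_def
      by (intro measurable_compose[OF _ measurable_ennreal] borel_measurable_sqrt borel_measurable_sum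
          borel_measurable_power borel_measurable_diff measurable_compose[OF measurable_fst]
          measurable_compose[OF measurable_snd] measurable_Rp_component) auto
    then show ?thesis by (subst nn_integral_distr) auto
  qed
  finally show ?thesis .
qed

lemma wasserstein1_self:
  assumes "prob_space P" "sets P = sets (Rp p)"
  shows "wasserstein1 p P P = 0"
  using wasserstein1_distr_le[OF assms, of "\<lambda>x. x"] assms(2)
  by (simp add: distr_id2 euclid_norm_def)

text \<open>The restriction keeps the image inside the space of \<open>Rp p\<close>, which consists
  of extensional functions.\<close>

definition scale0 :: "nat \<Rightarrow> real \<Rightarrow> (nat \<Rightarrow> real) \<Rightarrow> nat \<Rightarrow> real" where
  "scale0 p r x = (\<lambda>i\<in>{..<p}. if i = 0 then r * x i else x i)"

lemma measurable_scale0: "scale0 p r \<in> measurable (Rp p) (Rp p)"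
proof -
  have "(\<lambda>x. if i = 0 then r * x i else x i) \<in> measurable (Rp p) lborel" if "i < p" for i
    using measurable_Rp_component[OF that] by (cases "i = 0") auto
  then show ?thesis
    unfolding scale0_def Rp_def[of p] by (intro measurable_restrict) (auto simp: Rp_def)
qed

text \<open>Rescaling coordinate 0 of the point amounts to rescaling \<open>t 0\<close> in the
  characteristic function, so no transformed density is computed.\<close>

lemma gaussian_scale0:
  assumes p: "1 \<le> p" and s: "0 < s" and \<sigma>: "0 < \<sigma>"
  shows "gaussian p (star_cov (r * \<sigma>) s (\<lambda>_. 0)) (distr (star_law p \<sigma> s (\<lambda>_. 0)) (Rp p) (scale0 p r))"
proof -
  define P where "P = star_law p \<sigma> s (\<lambda>_. 0)"
  note measurable_Rp_component [measurable]
  interpret P: prob_space P unfolding P_def by (rule prob_space_star_law[OF p s \<sigma>])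
  have [measurable]: "scale0 p r \<in> measurable P (Rp p)"
    using measurable_scale0 by (simp add: P_def sets_star_law cong: measurable_cong_sets)
  have "(\<integral>x. cis (\<Sum>i<p. t i * x i) \<partial>distr P (Rp p) (scale0 p r))
      = complex_of_real (exp (- (\<Sum>i<p. \<Sum>j<p. t i * star_cov (r * \<sigma>) s (\<lambda>_. 0) i j * t j) / 2))" for t
  proof -
    define t' where "t' = t(0 := r * t 0)"
    have "(\<integral>x. cis (\<Sum>i<p. t i * x i) \<partial>distr P (Rp p) (scale0 p r))
      = (\<integral>x. cis (\<Sum>i<p. t i * scale0 p r x i) \<partial>P)"
      by (intro integral_distr) measurable
    also have "\<dots> = (\<integral>x. cis (\<Sum>i<p. t' i * x i) \<partial>P)"
      by (intro Bochner_Integration.integral_cong refl arg_cong[where f = cis] sum.cong)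
         (auto simp: scale0_def t'_def)
    also have "\<dots> = complex_of_real (exp (- (\<Sum>i<p. \<Sum>j<p. t' i * star_cov \<sigma> s (\<lambda>_. 0) i j * t' j) / 2))"
      using gaussian_star_law[OF p s \<sigma>, of "\<lambda>_. 0"] by (simp add: gaussian_def P_def)
    also have "(\<Sum>i<p. \<Sum>j<p. t' i * star_cov \<sigma> s (\<lambda>_. 0) i j * t' j)
      = (\<Sum>i<p. \<Sum>j<p. t i * star_cov (r * \<sigma>) s (\<lambda>_. 0) i j * t j)"
      unfolding star_cov_quadratic_form[OF p] by (simp add: t'_def power_mult_distrib)
    finally show ?thesis .
  qed
  then show ?thesis
    by (simp add: gaussian_def P_def[symmetric] P.prob_space_distr)
qed

lemma wasserstein1_scale0:
  assumes p: "1 \<le> p" and s: "0 < s" and r: "1 \<le> r"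
  shows "wasserstein1 p (distr (star_law p s s (\<lambda>_. 0)) (Rp p) (scale0 p r)) (star_law p s s (\<lambda>_. 0)) \<le> ennreal ((r - 1) * s)"
proof -
  define P where "P = star_law p s s (\<lambda>_. 0)"
  note measurable_Rp_component [measurable]
  have "wasserstein1 p (distr P (Rp p) (scale0 p r)) P
     \<le> (\<integral>\<^sup>+ x. ennreal (euclid_norm p (\<lambda>i. scale0 p r x i - x i)) \<partial>P)"
    unfolding P_def using p s
    by (intro wasserstein1_distr_le prob_space_star_law measurable_scale0) (auto simp: sets_star_law)
  also have "\<dots> = (\<integral>\<^sup>+ x. ennreal ((r - 1) * \<bar>x 0\<bar>) \<partial>P)"
  proof (intro nn_integral_cong arg_cong[where f = ennreal])
    fix x
    have "euclid_norm p (\<lambda>i. scale0 p r x i - x i) = sqrt (\<Sum>i<p. if i = 0 then ((r - 1) * x 0)\<^sup>2 else 0)"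
      unfolding euclid_norm_def
      by (intro arg_cong[where f = sqrt] sum.cong) (auto simp: scale0_def algebra_simps)
    also have "\<dots> = (r - 1) * \<bar>x 0\<bar>" using p r by (simp add: abs_mult)
    finally show "euclid_norm p (\<lambda>i. scale0 p r x i - x i) = (r - 1) * \<bar>x 0\<bar>" .
  qed
  \<comment> \<open>AM-GM replaces the absolute moment by the second moment
    \<open>s\<^sup>2\<close>, which gives mean at most \<open>s\<close>.\<close>
  also have "\<dots> \<le> (\<integral>\<^sup>+ x. ennreal ((r - 1) * ((s + (x 0)\<^sup>2 / s) / 2)) \<partial>P)"
  proof (intro nn_integral_mono ennreal_leI mult_left_mono)
    fix x :: "nat \<Rightarrow> real"
    have "0 \<le> (s - \<bar>x 0\<bar>)\<^sup>2" by simp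
    then have "2 * s * \<bar>x 0\<bar> \<le> s * s + (x 0)\<^sup>2" by (simp add: power2_eq_square algebra_simps)
    then show "\<bar>x 0\<bar> \<le> (s + (x 0)\<^sup>2 / s) / 2" using s by (simp add: field_simps power2_eq_square)
  qed (use r in auto)
  also have "\<dots> = (\<integral>\<^sup>+ x. ennreal (star_dens p s s (\<lambda>_. 0) x) * ennreal ((r - 1) * ((s + (x 0)\<^sup>2 / s) / 2)) \<partial>Rp p)"
    unfolding P_def star_law_def using p by (intro nn_integral_density) auto
  also have "\<dots> = (\<integral>\<^sup>+ y. ennreal (normal_density 0 s y) * ennreal ((r - 1) * ((s + y\<^sup>2 / s) / 2)) \<partial>lborel)"
    using p s by (intro nn_integral_star_dens) auto
  also have "\<dots> = (\<integral>\<^sup>+ y. ennreal ((r - 1) / 2 * (s * normal_density 0 s y + normal_density 0 s y * y\<^sup>2 / s)) \<partial>lborel)"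
  proof (rule nn_integral_cong)
    fix y
    have "normal_density 0 s y * ((r - 1) * ((s + y\<^sup>2 / s) / 2))
      = (r - 1) / 2 * (s * normal_density 0 s y + normal_density 0 s y * y\<^sup>2 / s)"
      by (simp add: distrib_left mult_ac)
    then show "ennreal (normal_density 0 s y) * ennreal ((r - 1) * ((s + y\<^sup>2 / s) / 2))
      = ennreal ((r - 1) / 2 * (s * normal_density 0 s y + normal_density 0 s y * y\<^sup>2 / s))"
      using s r by (subst ennreal_mult[symmetric]) auto
  qed
  also have "\<dots> = ennreal (\<integral>y. (r - 1) / 2 * (s * normal_density 0 s y + normal_density 0 s y * y\<^sup>2 / s) \<partial>lborel)"
    using s r has_bochner_integral_normal_density_square[OF s]
    by (intro nn_integral_eq_integral) (auto simp: has_bochner_integral_iff)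
  also have "(\<integral>y. (r - 1) / 2 * (s * normal_density 0 s y + normal_density 0 s y * y\<^sup>2 / s) \<partial>lborel) = (r - 1) * s"
    using s has_bochner_integral_normal_density_square[OF s] by (simp add: has_bochner_integral_iff power2_eq_square)
  finally show ?thesis by (simp add: P_def)
qed

subsection \<open>The minimax bound\<close>

text \<open>\<open>measure\<close> is zero on nonmeasurable sets, so monotonicity and subadditivity
  for the loss event depend on this.\<close>

lemma measurable_loss_event:
  assumes E: "estimator p n E" and P: "sets P = sets (Rp p)"
  shows "{X \<in> space (PiM {..<n} (\<lambda>_. P)). r \<le> spec_norm p (\<lambda>i j. S i j - E X i j)}
    \<in> sets (PiM {..<n} (\<lambda>_. P))"
proof -
  have "sets (PiM {..<n} (\<lambda>_. P)) = sets (PiM {..<n} (\<lambda>_. Rp p))"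
    using P by (intro sets_PiM_cong) auto
  then have "(\<lambda>X. E X i j) \<in> borel_measurable (PiM {..<n} (\<lambda>_. P))" if "i < p" "j < p" for i j
    using E that unfolding estimator_def by (auto cong: measurable_cong_sets)
  then have [measurable]: "(\<lambda>X. spec_norm p (\<lambda>i j. S i j - E X i j)) \<in> borel_measurable (PiM {..<n} (\<lambda>_. P))"
    by (intro borel_measurable_spec_norm) auto
  show ?thesis by measurable
qed

text \<open>Thresholding column 0 of the estimate tests all signs. Every wrong sign costs at least
  \<open>h\<close> in its entry of that column, and the column norm is at most the spectral
  norm.\<close>

lemma hypercube_lower_bound:
  assumes p: "1 \<le> p" "p \<le> n" and A: "0 < A" and t: "0 < t" "t \<le> 1/2" "t\<^sup>2 \<le> 1 / (8 * real n)"
    and E: "estimator p n E" and r: "r \<le> A * t / 8 * sqrt (real p)"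
  defines "P \<equiv> \<lambda>v. star_law p (sqrt (A / (1 - v 0 * t))) (sqrt A) (\<lambda>j. t * v j)"
    and "S \<equiv> \<lambda>v. star_cov (sqrt (A / (1 - v 0 * t))) (sqrt A) (\<lambda>j. t * v j)"
  shows "\<exists>v\<in>sign_cube p. 1/8 \<le> measure (PiM {..<n} (\<lambda>_. P v))
    {X \<in> space (PiM {..<n} (\<lambda>_. P v)). r \<le> spec_norm p (\<lambda>i j. S v i j - E X i j)}"
proof -
  define M where "M = PiM {..<n} (\<lambda>_. Rp p)"
  \<comment> \<open>The threshold separating the two signs: entry 0 of the column is a variance near
    \<open>A\<close>, the others are covariances near 0.\<close>
  define m where "m j = (if j = 0 then A else 0 :: real)" for j :: nat
  define D where "D j = {X \<in> space M. m j \<le> E X j 0}" for j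
  \<comment> \<open>The entries deviate from \<open>m j\<close> by at least
    \<open>A * t / (1 + t)\<close>, which is at least \<open>h\<close> because
    \<open>t \<le> 1\<close>.\<close>
  define h where "h = A * t / 2"
  have n: "1 \<le> n" using p by simp
  have v0: "v 0 = 1 \<or> v 0 = -1" if "v \<in> sign_cube p" for v
    using that p by (auto simp: sign_cube_def PiE_iff)
  have var_pos: "0 < A / (1 - v 0 * t)" if "v \<in> sign_cube p" for v using v0[OF that] A t by auto
  have prob: "prob_space (P v)" if "v \<in> sign_cube p" for v
    unfolding P_def using var_pos[OF that] p A by (intro prob_space_star_law) auto
  have setsP: "sets (P v) = sets (Rp p)" for v by (simp add: P_def sets_star_law)
  have setsM: "sets (PiM {..<n} (\<lambda>_. P v)) = sets M" for v
    unfolding M_def by (intro sets_PiM_cong) (auto simp: setsP)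
  have spM: "space (PiM {..<n} (\<lambda>_. P v)) = space M" for v by (rule sets_eq_imp_space_eq[OF setsM])
  have sf: "sigma_finite_measure (Rp p)"
    unfolding Rp_def by (rule lborel_pr.sigma_finite) simp
  have "\<exists>v\<in>sign_cube p. 1/8 \<le> measure (PiM {..<n} (\<lambda>_. P v))
    {X \<in> space M. real p / 8 \<le> real (card {j. j < p \<and> (v j = 1 \<longleftrightarrow> X \<notin> D j)})}"
  proof (rule assouad[OF p(1)])
    show "prob_space (PiM {..<n} (\<lambda>_. P v))" if "v \<in> sign_cube p" for v
      using prob[OF that] by (intro prob_space_PiM)
    show "sets (PiM {..<n} (\<lambda>_. P v)) = sets M" for v by (rule setsM)
    show "D j \<in> sets M" if "j < p" for j
    proof -
      have [measurable]: "(\<lambda>X. E X j 0) \<in> borel_measurable M"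
        using E that unfolding estimator_def M_def by auto
      show ?thesis unfolding D_def by measurable
    qed
    show "1/2 \<le> measure (PiM {..<n} (\<lambda>_. P v)) B + measure (PiM {..<n} (\<lambda>_. P (flip_at j v))) (space M - B)"
      if v: "v \<in> sign_cube p" and j: "j < p" and B: "B \<in> sets M" for v j B
    proof -
      have dens: "P w = density (Rp p) (\<lambda>x. ennreal (hyper_dens p A t w x))" for w
        by (simp add: P_def star_law_def hyper_dens_def)
      have "ennreal (1 - 1 / (8 * real n)) \<le> ennreal (1 - t\<^sup>2)" using t by (intro ennreal_leI) auto
      also have "\<dots> \<le> (\<integral>\<^sup>+ x. ennreal (sqrt (hyper_dens p A t v x * hyper_dens p A t (flip_at j v) x)) \<partial>Rp p)"
        using p A t v j by (intro hyper_dens_affinity) auto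
      finally show ?thesis
        using prob[OF v] prob[OF flip_at_sign_cube[OF j v]] B n p sf unfolding dens M_def
        by (intro testing_lower_bound_iid) (auto simp: hyper_dens_def star_dens_nonneg)
    qed
  qed
  then obtain v where v: "v \<in> sign_cube p" and le: "1/8 \<le> measure (PiM {..<n} (\<lambda>_. P v))
    {X \<in> space M. real p / 8 \<le> real (card {j. j < p \<and> (v j = 1 \<longleftrightarrow> X \<notin> D j)})}" by blast
  have h0: "0 < h" using A t by (simp add: h_def)
  have up: "m j + h \<le> S v j 0" if "v j = 1" for j
  proof (cases "j = 0")
    case True
    have "A + h \<le> A / (1 - t)"
      using A t by (simp add: h_def field_simps)
    then show ?thesis using True that var_pos[OF v] by (simp add: S_def star_cov_col0 m_def)
  next
    case False
    have "h \<le> A / (1 - v 0 * t) * t"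
      using v0[OF v] A t by (auto simp: h_def field_simps)
    then show ?thesis using False that var_pos[OF v] by (simp add: S_def star_cov_col0 m_def)
  qed
  have down: "S v j 0 \<le> m j - h" if "v j = -1" for j
  proof (cases "j = 0")
    case True
    have "A / (1 + t) \<le> A - h"
      using A t by (simp add: h_def field_simps)
    then show ?thesis using True that var_pos[OF v] by (simp add: S_def star_cov_col0 m_def)
  next
    case False
    have "h \<le> A / (1 - v 0 * t) * t"
      using v0[OF v] A t by (auto simp: h_def field_simps)
    then show ?thesis using False that var_pos[OF v] by (simp add: S_def star_cov_col0 m_def)
  qed
  have "r \<le> spec_norm p (\<lambda>i j. S v i j - E X i j)"
    if X: "X \<in> space M" and c: "real p / 8 \<le> real (card {j. j < p \<and> (v j = 1 \<longleftrightarrow> X \<notin> D j)})" for X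
  proof -
    let ?J = "{j. j < p \<and> (v j = 1 \<longleftrightarrow> X \<notin> D j)}"
    have err: "h\<^sup>2 \<le> (S v j 0 - E X j 0)\<^sup>2" if "j \<in> ?J" for j
    proof -
      have "v j = 1 \<or> v j = -1" using that v by (auto simp: sign_cube_def PiE_iff)
      then have "h \<le> \<bar>S v j 0 - E X j 0\<bar>"
        using that X up[of j] down[of j] by (auto simp: D_def)
      then show ?thesis using h0 by (simp add: abs_le_square_iff[symmetric])
    qed
    \<comment> \<open>At least \<open>p / 8\<close> wrong signs give column norm at least
      \<open>h * sqrt (p / 8)\<close>; weakening 8 to 16 makes the constant rational.\<close>
    have "r \<le> h / 4 * sqrt (real p)" using r by (simp add: h_def)
    also have "\<dots> = sqrt (h\<^sup>2 * (real p / 16))"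
      using h0 by (simp add: real_sqrt_mult real_sqrt_divide)
    also have "\<dots> \<le> sqrt (\<Sum>j\<in>?J. h\<^sup>2)"
    proof (intro real_sqrt_le_mono)
      have "h\<^sup>2 * (real p / 16) \<le> h\<^sup>2 * real (card ?J)" using c by (intro mult_left_mono) auto
      then show "h\<^sup>2 * (real p / 16) \<le> (\<Sum>j\<in>?J. h\<^sup>2)" by (simp add: mult.commute)
    qed
    also have "\<dots> \<le> sqrt (\<Sum>j\<in>?J. (S v j 0 - E X j 0)\<^sup>2)"
      using err by (intro real_sqrt_le_mono sum_mono) auto
    also have "\<dots> \<le> sqrt (\<Sum>j<p. (S v j 0 - E X j 0)\<^sup>2)"
      by (intro real_sqrt_le_mono sum_mono2) auto
    also have "\<dots> \<le> spec_norm p (\<lambda>i j. S v i j - E X i j)"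
      using p by (intro column_le_spec_norm) auto
    finally show ?thesis .
  qed
  then have sub: "{X \<in> space M. real p / 8 \<le> real (card {j. j < p \<and> (v j = 1 \<longleftrightarrow> X \<notin> D j)})}
    \<subseteq> {X \<in> space (PiM {..<n} (\<lambda>_. P v)). r \<le> spec_norm p (\<lambda>i j. S v i j - E X i j)}"
    unfolding spM by auto
  interpret PP: prob_space "PiM {..<n} (\<lambda>_. P v)" using prob[OF v] by (intro prob_space_PiM)
  have "1/8 \<le> measure (PiM {..<n} (\<lambda>_. P v)) {X \<in> space (PiM {..<n} (\<lambda>_. P v)). r \<le> spec_norm p (\<lambda>i j. S v i j - E X i j)}"
    using le PP.finite_measure_mono[OF sub measurable_loss_event[OF E setsP]] by linarith
  then show ?thesis using v by blast
qed

text \<open>The data law does not reveal which of \<open>S\<close> and \<open>S'\<close> is true. No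
  estimate has loss below \<open>r\<close> for both, so the two loss events cover the sample
  space.\<close>

lemma same_law_lower_bound:
  assumes P: "prob_space P" "sets P = sets (Rp p)" and E: "estimator p n E" and p: "1 \<le> p"
    and sep: "2 * r \<le> \<bar>S 0 0 - S' 0 0\<bar>"
  shows "\<exists>T\<in>{S, S'}. 1/2 \<le> measure (PiM {..<n} (\<lambda>_. P))
    {X \<in> space (PiM {..<n} (\<lambda>_. P)). r \<le> spec_norm p (\<lambda>i j. T i j - E X i j)}"
proof -
  let ?M = "PiM {..<n} (\<lambda>_. P)"
  define L where "L T = {X \<in> space ?M. r \<le> spec_norm p (\<lambda>i j. T i j - E X i j)}" for T
  interpret PP: prob_space ?M using P by (intro prob_space_PiM)
  have L: "L T \<in> sets ?M" for T unfolding L_def by (rule measurable_loss_event[OF E P(2)])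
  have "space ?M \<subseteq> L S \<union> L S'"
  proof
    fix X assume X: "X \<in> space ?M"
    have "\<bar>T 0 0 - E X 0 0\<bar> \<le> spec_norm p (\<lambda>i j. T i j - E X i j)" for T
      using p entry_le_spec_norm[of 0 p 0 "\<lambda>i j. T i j - E X i j"] by simp
    from this[of S] this[of S'] sep show "X \<in> L S \<union> L S'" using X by (auto simp: L_def)
  qed
  then have "1 \<le> measure ?M (L S \<union> L S')"
    using PP.finite_measure_mono[of "space ?M" "L S \<union> L S'"] L by (simp add: PP.prob_space)
  also have "\<dots> \<le> measure ?M (L S) + measure ?M (L S')" using L by (intro measure_Un_le) auto
  finally have "1/2 \<le> measure ?M (L S) \<or> 1/2 \<le> measure ?M (L S')" by linarith
  then show ?thesis unfolding L_def by auto
qed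

text \<open>The infimum over estimators becomes the quantifier over \<open>E\<close>. Some upper
  bound on \<open>p / n\<close> and \<open>\<epsilon>\<close> is unavoidable: matrices in
  \<open>Theta M1 M2 p\<close> have spectral norm at most \<open>M2\<close>, so the zero estimator
  never incurs a loss above \<open>M2\<close>.\<close>

theorem theorem10:
  fixes M1 M2 :: real
  assumes "0 < M1" and "M1 < M2"
  shows "\<exists>C>0. \<exists>c>0. \<forall>p n (\<epsilon>::real). 1 \<le> p \<longrightarrow> p \<le> n \<longrightarrow> 0 \<le> \<epsilon> \<longrightarrow> \<epsilon> \<le> 1 \<longrightarrow>
    (\<forall>E. estimator p n E \<longrightarrow>
       c \<le> Sup {measure (PiM {..<n} (\<lambda>_. P))
                  {X \<in> space (PiM {..<n} (\<lambda>_. P)).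
                     C * max (sqrt (real p / real n)) \<epsilon> \<le> spec_norm p (\<lambda>i j. S i j - E X i j)}
               | S G P. S \<in> Theta M1 M2 p \<and> gaussian p S G \<and> prob_space P \<and>
                        sets P = sets (Rp p) \<and> wasserstein1 p G P \<le> ennreal \<epsilon>})"
proof -
  define A where "A = (M1 + M2) / 2"
  define d where "d = (M2 - M1) / 4"
  \<comment> \<open>With \<open>t = \<kappa> / sqrt n\<close> this gives
    \<open>2 * A * t \<le> d\<close> and \<open>M2 * \<kappa>\<^sup>2 < d\<^sup>2 / M2\<close>, as
    \<open>star_cov_in_Theta\<close> requires, and \<open>\<kappa> \<le> 1/8\<close> gives the bound
    on \<open>t\<^sup>2\<close>.\<close>
  define \<kappa> where "\<kappa> = d / (2 * M2)"
  \<comment> \<open>With \<open>\<delta> = \<beta> * \<epsilon>\<close>, the first bound keeps the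
    transport cost \<open>\<delta> * sqrt A\<close> below \<open>\<epsilon>\<close>, the second
    keeps the rescaled variance within \<open>d\<close> of \<open>A\<close>.\<close>
  define \<beta> where "\<beta> = min (1 / sqrt A) (d / (3 * A))"
  define C where "C = min (A * \<kappa> / 8) (A * \<beta>)"
  have d0: "0 < d" and A0: "0 < A" and dA: "d \<le> A / 2" and AM: "A + d \<le> M2" and M20: "0 < M2"
    using assms by (auto simp: d_def A_def field_simps)
  have \<kappa>0: "0 < \<kappa>" and \<kappa>1: "\<kappa> \<le> 1/8" using assms by (auto simp: \<kappa>_def d_def field_simps)
  have \<beta>0: "0 < \<beta>" using d0 A0 by (simp add: \<beta>_def)
  have C0: "0 < C" using \<kappa>0 \<beta>0 A0 by (simp add: C_def)
  have "1/8 \<le> Sup {measure (PiM {..<n} (\<lambda>_. P))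
                  {X \<in> space (PiM {..<n} (\<lambda>_. P)).
                     C * max (sqrt (real p / real n)) \<epsilon> \<le> spec_norm p (\<lambda>i j. S i j - E X i j)}
               | S G P. S \<in> Theta M1 M2 p \<and> gaussian p S G \<and> prob_space P \<and>
                        sets P = sets (Rp p) \<and> wasserstein1 p G P \<le> ennreal \<epsilon>}" (is "_ \<le> Sup ?Z")
    if p: "1 \<le> p" "p \<le> n" and \<epsilon>: "0 \<le> \<epsilon>" "\<epsilon> \<le> 1" and E: "estimator p n E" for p n \<epsilon> E
  proof -
    define r where "r = C * max (sqrt (real p / real n)) \<epsilon>"
    let ?R = "\<lambda>S P. measure (PiM {..<n} (\<lambda>_. P))
      {X \<in> space (PiM {..<n} (\<lambda>_. P)). r \<le> spec_norm p (\<lambda>i j. S i j - E X i j)}"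
    have "bdd_above ?Z"
      by (rule bdd_aboveI[of _ 1]) (auto intro!: prob_space.prob_le_1 prob_space_PiM)
    then have upper: "?R S P \<le> Sup ?Z"
      if "S \<in> Theta M1 M2 p" "gaussian p S G" "prob_space P" "sets P = sets (Rp p)" "wasserstein1 p G P \<le> ennreal \<epsilon>" for S G P
      using that unfolding r_def by (intro cSup_upper) blast
    show ?thesis
    proof (cases "\<epsilon> \<le> sqrt (real p / real n)")
      case True
      define t where "t = \<kappa> / sqrt (real n)"
      have n1: "1 \<le> real n" using p by simp
      have t0: "0 < t" using \<kappa>0 n1 by (simp add: t_def)
      have t\<kappa>: "t \<le> \<kappa>" using \<kappa>0 n1 by (simp add: t_def field_simps)
      have t2: "t\<^sup>2 = \<kappa>\<^sup>2 / real n" by (simp add: t_def power_divide)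
      have "\<kappa>\<^sup>2 \<le> (1/8)\<^sup>2" using \<kappa>0 \<kappa>1 by (intro power_mono) auto
      then have "\<kappa>\<^sup>2 \<le> 1/8" by (simp add: power_divide)
      then have "t\<^sup>2 \<le> 1/8 / real n" unfolding t2 by (rule divide_right_mono) simp
      then have "t\<^sup>2 \<le> 1 / (8 * real n)" by simp
      moreover have "r \<le> A * t / 8 * sqrt (real p)"
      proof -
        have "r \<le> A * \<kappa> / 8 * sqrt (real p / real n)"
          unfolding r_def max_absorb1[OF True] by (rule mult_right_mono) (simp_all add: C_def)
        then show ?thesis by (simp add: t_def real_sqrt_divide)
      qed
      ultimately obtain v where v: "v \<in> sign_cube p" and le:
        "1/8 \<le> ?R (star_cov (sqrt (A / (1 - v 0 * t))) (sqrt A) (\<lambda>j. t * v j))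
                 (star_law p (sqrt (A / (1 - v 0 * t))) (sqrt A) (\<lambda>j. t * v j))"
        using hypercube_lower_bound[OF p A0 t0 _ _ E] t\<kappa> \<kappa>1 by auto
      define \<sigma> where "\<sigma> = sqrt (A / (1 - v 0 * t))"
      have v0: "v 0 = 1 \<or> v 0 = -1" using v p by (auto simp: sign_cube_def PiE_iff)
      have var_pos: "0 < A / (1 - v 0 * t)" using v0 A0 t\<kappa> \<kappa>1 t0 by auto
      then have \<sigma>0: "0 < \<sigma>" and \<sigma>2: "\<sigma>\<^sup>2 = A / (1 - v 0 * t)" by (auto simp: \<sigma>_def)
      have "2 * A * t \<le> d"
      proof -
        have "2 * A * t \<le> 2 * M2 * \<kappa>" using t\<kappa> t0 AM d0 M20 A0 by (intro mult_mono) auto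
        then show ?thesis using M20 by (simp add: \<kappa>_def)
      qed
      moreover have "A / (1 - t) - A \<le> 2 * A * t" "A - A / (1 + t) \<le> 2 * A * t"
        "A \<le> A / (1 - t)" "A / (1 + t) \<le> A"
        using A0 t0 t\<kappa> \<kappa>1 by (auto simp: field_simps) 
      ultimately have \<sigma>A: "\<bar>\<sigma>\<^sup>2 - A\<bar> \<le> d" using v0 by (auto simp: \<sigma>2)
      have "(\<Sum>j=1..<p. (t * v j)\<^sup>2) = (\<Sum>j=1..<p. t\<^sup>2)"
      proof (rule sum.cong[OF refl])
        fix j assume "j \<in> {1..<p}"
        then have "v j = 1 \<or> v j = -1" using v by (auto simp: sign_cube_def PiE_iff)
        then show "(t * v j)\<^sup>2 = t\<^sup>2" by (auto simp: power_mult_distrib)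
      qed
      also have "\<dots> \<le> \<kappa>\<^sup>2"
      proof -
        \<comment> \<open>Here \<open>p \<le> n\<close> enters: the squared regression coefficients
          sum to at most \<open>\<kappa>\<^sup>2\<close>, uniformly in \<open>p\<close> and
          \<open>n\<close>.\<close>
        have "real (p - 1) * \<kappa>\<^sup>2 \<le> real n * \<kappa>\<^sup>2" using p by (intro mult_right_mono) auto
        then show ?thesis using n1 by (simp add: t2 field_simps)
      qed
      finally have "\<sigma>\<^sup>2 * (\<Sum>j=1..<p. (t * v j)\<^sup>2) \<le> M2 * \<kappa>\<^sup>2"
        using \<sigma>A AM M20 by (intro mult_mono) (auto simp: abs_le_iff intro: sum_nonneg)
      also have "\<dots> < d\<^sup>2 / M2" using M20 d0 by (simp add: \<kappa>_def power2_eq_square field_simps)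
      finally have "star_cov \<sigma> (sqrt A) (\<lambda>j. t * v j) \<in> Theta M1 M2 p"
        using p assms \<sigma>A A0 d0 unfolding A_def d_def by (intro star_cov_in_Theta) auto
      \<comment> \<open>No contamination is used in this regime: \<open>G\<close> and
        \<open>P\<close> coincide, at distance 0.\<close>
      then have "?R (star_cov \<sigma> (sqrt A) (\<lambda>j. t * v j)) (star_law p \<sigma> (sqrt A) (\<lambda>j. t * v j)) \<le> Sup ?Z"
        using p A0 \<sigma>0
        by (intro upper[where G = "star_law p \<sigma> (sqrt A) (\<lambda>j. t * v j)"] gaussian_star_law)
           (auto simp: sets_star_law wasserstein1_self prob_space_star_law)
      then show ?thesis using le by (simp add: \<sigma>_def)
    next
      case False
      define \<delta> where "\<delta> = \<beta> * \<epsilon>"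
      define s where "s = sqrt A"
      define P where "P = star_law p s s (\<lambda>_. 0)"
      define G where "G = distr P (Rp p) (scale0 p (1 + \<delta>))"
      have s0: "0 < s" and s2: "s\<^sup>2 = A" using A0 by (simp_all add: s_def)
      have \<delta>0: "0 \<le> \<delta>" using \<beta>0 \<epsilon> by (simp add: \<delta>_def)
      have "\<delta> \<le> \<beta>" using \<beta>0 \<epsilon> by (simp add: \<delta>_def mult_left_le)
      then have "\<delta> \<le> d / (3 * A)" by (simp add: \<beta>_def)
      then have \<delta>A: "3 * (A * \<delta>) \<le> d" using A0 by (simp add: field_simps)
      then have "A * \<delta> \<le> A * 1" using dA A0 by linarith
      then have \<delta>1: "\<delta> \<le> 1" using A0 by simp
      \<comment> \<open>The change of variance lies between \<open>2 * A * \<delta>\<close> and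
        \<open>3 * A * \<delta>\<close>: the lower bound separates the two covariances, the upper
        one keeps the rescaled covariance in \<open>Theta M1 M2 p\<close>.\<close>
      have "((1 + \<delta>) * s)\<^sup>2 - A = 2 * (A * \<delta>) + A * (\<delta> * \<delta>)"
        unfolding power_mult_distrib s2 by (simp add: power2_eq_square algebra_simps)
      moreover have "A * (\<delta> * \<delta>) \<le> A * (\<delta> * 1)" using \<delta>0 \<delta>1 A0 by (intro mult_left_mono) auto
      moreover have "0 \<le> A * (\<delta> * \<delta>)" using A0 \<delta>0 by simp
      ultimately have sq: "((1 + \<delta>) * s)\<^sup>2 - A \<le> 3 * (A * \<delta>)" "2 * (A * \<delta>) \<le> ((1 + \<delta>) * s)\<^sup>2 - A"
        by linarith+
      have Th: "star_cov \<sigma> s (\<lambda>_. 0) \<in> Theta M1 M2 p" if "\<bar>\<sigma>\<^sup>2 - A\<bar> \<le> d" for \<sigma>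
        using that d0 M20 by (intro star_cov_in_Theta[OF p(1) assms, folded A_def d_def]) (auto simp: s2)
      have "r \<le> A * \<delta>"
        unfolding r_def \<delta>_def using False \<epsilon> by (auto simp: C_def max_def mult.assoc[symmetric] intro!: mult_right_mono)
      then have "2 * r \<le> \<bar>star_cov ((1 + \<delta>) * s) s (\<lambda>_. 0) 0 0 - star_cov s s (\<lambda>_. 0) 0 0\<bar>"
        using sq(2) by (simp add: star_cov_col0 s2)
      moreover have prP: "prob_space P" and seP: "sets P = sets (Rp p)"
        using p s0 by (auto simp: P_def sets_star_law prob_space_star_law)
      ultimately obtain T where T: "T = star_cov ((1 + \<delta>) * s) s (\<lambda>_. 0) \<or> T = star_cov s s (\<lambda>_. 0)"
        and le: "1/2 \<le> ?R T P"
        using same_law_lower_bound[OF _ _ E p(1), of P r] by blast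
      \<comment> \<open>Whichever covariance is badly estimated, it is admissible with data law
        \<open>P\<close>: the rescaled one through contamination of \<open>G\<close>, the other with
        \<open>P\<close> itself as the true Gaussian.\<close>
      have "?R (star_cov ((1 + \<delta>) * s) s (\<lambda>_. 0)) P \<le> Sup ?Z"
      proof (rule upper[OF Th _ prP seP])
        show "\<bar>((1 + \<delta>) * s)\<^sup>2 - A\<bar> \<le> d"
          using sq \<delta>A A0 \<delta>0 mult_nonneg_nonneg[of A \<delta>] by linarith
        show "gaussian p (star_cov ((1 + \<delta>) * s) s (\<lambda>_. 0)) G"
          unfolding G_def P_def using p s0 by (intro gaussian_scale0)
        have "wasserstein1 p G P \<le> ennreal ((1 + \<delta> - 1) * s)"
          unfolding G_def P_def using p s0 \<delta>0 by (intro wasserstein1_scale0) auto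
        also have "(1 + \<delta> - 1) * s \<le> \<epsilon>"
        proof -
          have "\<beta> * s \<le> 1 / s * s" using s0 by (intro mult_right_mono) (auto simp: \<beta>_def s_def)
          then have "\<beta> * s * \<epsilon> \<le> 1 * \<epsilon>" using s0 \<epsilon> by (intro mult_right_mono) auto
          then show ?thesis by (simp add: \<delta>_def mult_ac)
        qed
        finally show "wasserstein1 p G P \<le> ennreal \<epsilon>" by (simp add: ennreal_leI)
      qed
      moreover have "?R (star_cov s s (\<lambda>_. 0)) P \<le> Sup ?Z"
      proof (rule upper[OF Th _ prP seP])
        show "gaussian p (star_cov s s (\<lambda>_. 0)) P" unfolding P_def using p s0 by (intro gaussian_star_law)
      qed (use d0 s2 wasserstein1_self[OF prP seP] in auto)
      ultimately show ?thesis using le T by auto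
    qed
  qed
  then show ?thesis using C0 by (intro exI[of _ C] conjI exI[of _ "1/8"]) auto
qed

end
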